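(* Assume the $abc$ conjecture. Let $n\ge 5$ be an odd integer with $n\equiv 1 \pmod 4$, and fix $\delta_0>0$. For integers $A>1$, $B>1$, let $\mathcal M_n(A,B)$ be the set of pairs $(a,b)\in\mathbb Z^2$ with $A\le |a|\le 2A$ and $B\le |b|\le 2B$ such that the trinomial $f(t)=t^n+at+b$ is irreducible over $\mathbb Q$ and its discriminant $D_f$ is squarefree. Then there is a constant $c>0$ (depending on $n$ and $\delta_0$) such that for all sufficiently large $A$ and all $B>A^{1+\delta_0}$, $$\#\mathcal M_n(A,B)\ge c\,AB.$$
   Context: The $abc$ conjecture: for every $\epsilon>0$ there is a constant $C_\epsilon$ such that whenever $a,b,c$ are coprime positive integers with $a+b=c$, one has $c\le C_\epsilon\, N(a,b,c)^{1+\epsilon}$, where $N(a,b,c)$ is the product of the distinct primes dividing $abc$. *)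

theory Defs
  imports Complex_Main "Subresultants.Resultant_Prelim"
    "HOL-Computational_Algebra.Squarefree" "HOL-Computational_Algebra.Primes"
begin

definition rad :: "nat \<Rightarrow> nat" where
  "rad m = (\<Prod>p\<in>prime_factors m. p)"

definition abc_conjecture :: bool where
  "abc_conjecture \<longleftrightarrow>
     (\<forall>\<epsilon>::real. \<epsilon> > 0 \<longrightarrow> (\<exists>C::real. \<forall>a b c :: nat.
        a > 0 \<and> b > 0 \<and> c > 0 \<and> coprime a b \<and> coprime a c \<and> coprime b c \<and> a + b = c
        \<longrightarrow> real c \<le> C * real (rad (a * b * c)) powr (1 + \<epsilon>)))"

definition poly_disc :: "int poly \<Rightarrow> int" where
  "poly_disc f = ((-1) ^ (degree f * (degree f - 1) div 2) * resultant f (pderiv f)) div lead_coeff f"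

definition trinomial :: "nat \<Rightarrow> int \<Rightarrow> int \<Rightarrow> int poly" where
  "trinomial n a b = monom 1 n + [:b, a:]"

definition M_set :: "nat \<Rightarrow> int \<Rightarrow> int \<Rightarrow> (int \<times> int) set" where
  "M_set n A B = {(a, b). A \<le> \<bar>a\<bar> \<and> \<bar>a\<bar> \<le> 2 * A \<and> B \<le> \<bar>b\<bar> \<and> \<bar>b\<bar> \<le> 2 * B \<and>
      irreducible (map_poly (of_int :: int \<Rightarrow> rat) (trinomial n a b)) \<and>
      squarefree (poly_disc (trinomial n a b))}"

end

theory Submission
  imports Defs "Subresultants.Subresultant" "Berlekamp_Zassenhaus.Factor_Bound"
    "HOL-Number_Theory.Residue_Primitive_Roots"
begin

text \<open>
  Put \<open>u = n^n b^(n-1)\<close> and \<open>v = (n-1)^(n-1) a^n\<close>. As \<open>n\<close> is 1 modulo 4, the trinomials with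
  parameters \<open>(a, b)\<close> and \<open>(-a, b)\<close> have discriminants \<open>u + v\<close> and \<open>u - v\<close>, whose product is
  \<open>u^2 - v^2\<close>. If \<open>p^2\<close> divides the first and \<open>q^2\<close> the second, the abc conjecture applied
  to \<open>v^2 + (u^2 - v^2) = u^2\<close> gives \<open>p q = O(a b B^\<epsilon>)\<close>, which is smaller than any fixed multiple of
  \<open>B^2\<close> because \<open>B > A^(1 + \<delta>)\<close>. So for every constant \<open>K\<close>, at least one of \<open>(a, b)\<close> and \<open>(-a, b)\<close>
  has a discriminant without prime square factors beyond \<open>B / K\<close>.

  The primes up to \<open>B / K\<close> are removed by an elementary sieve in a fixed pair of residue classes,
  chosen such that no small prime divides either discriminant. Since the number of residues \<open>b\<close>
  modulo \<open>p^2\<close> to be avoided is at most \<open>n - 1\<close>, the trivial bound on the number of primes up to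
  \<open>B / K\<close> suffices once \<open>K\<close> is large.

  The same residue classes force irreducibility: if a monic factor \<open>g\<close> of degree \<open>d\<close> divides
  \<open>t^n + a t + b\<close>, then multiplying \<open>\<alpha>^n = - (a \<alpha> + b)\<close> over the roots \<open>\<alpha>\<close> of \<open>g\<close> shows that
  \<open>b^d\<close> is an \<open>n\<close>-th power modulo \<open>a\<close>. If \<open>b\<close> is a primitive root modulo suitable primes dividing
  \<open>a\<close>, this forces \<open>n\<close> to divide \<open>d\<close>.
\<close>

text \<open>
  \<open>Berlekamp_Zassenhaus\<close> hides the standard \<open>coprime\<close> behind its own constant of the same name;
  hence the qualified name throughout.
\<close>

hide_const (open) up_ring.coeff up_ring.monom

section \<open>The discriminant of a trinomial\<close>

lemma degree_trinomial: "n \<ge> 2 \<Longrightarrow> degree (trinomial n a b) = n"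
  unfolding trinomial_def
  by (subst degree_add_eq_left) (auto simp: degree_monom_eq intro: le_less_trans[OF degree_pCons_le])

lemma lead_coeff_trinomial: "n \<ge> 2 \<Longrightarrow> lead_coeff (trinomial n a b) = 1"
  by (simp add: degree_trinomial) (auto simp: trinomial_def coeff_pCons split: nat.splits)

lemma poly_trinomial: "poly (map_poly of_int (trinomial n a b)) x = x ^ n + of_int a * x + (of_int b :: 'a :: comm_ring_1)"
  unfolding trinomial_def by (simp add: of_int_hom.map_poly_hom_add poly_monom hom_distribs algebra_simps)

text \<open>Pseudo-division by a linear polynomial leaves the constant \<open>r\<close>, which is
  \<open>c ^ m\<close> times the value of \<open>G\<close> at the root -e/c. Up to the sign
  \<open>(-1) ^ m\<close> this is the resultant, and the factor \<open>c ^ m\<close> introduced by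
  the pseudo-division cancels.\<close>

lemma resultant_linear_remainder:
  fixes G Q :: "'a :: idom poly"
  assumes eq: "smult (c ^ m) G + Q * [:e, c:] = [:r:]" and m: "degree G = m" "m > 0" and c: "c \<noteq> 0"
  shows "resultant G [:e, c:] = (-1) ^ m * r"
proof -
  have "subresultant 0 (smult (c ^ m) G) [:e, c:] = smult ((-1) ^ m * c ^ m) [:r:]"
    using BT_eq_19[OF eq, of 0] m c by simp
  then have "resultant (smult (c ^ m) G) [:e, c:] = (-1) ^ m * c ^ m * r"
    by (simp add: subresultant_resultant)
  moreover have "resultant (smult (c ^ m) G) [:e, c:] = c ^ m * resultant G [:e, c:]"
    using resultant_smult_left[of "c ^ m" G "[:e, c:]"] c by simp
  ultimately show ?thesis using c by simp
qed

lemma minus_power_dvd_diff: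
  fixes x y :: "'a :: comm_ring_1"
  shows "x - y dvd x ^ m - y ^ m"
  by (metis dvdI power_diff_sumr2)

lemma pderiv_trinomial: "n > 0 \<Longrightarrow> pderiv (trinomial n a b) = monom (int n) (n - 1) + [:a:]"
  unfolding trinomial_def by (simp add: pderiv_add pderiv_monom pderiv_pCons)

text \<open>The combination n f - t f' is the linear polynomial (n-1) a t + n b, so a single
  Euclidean step reduces the resultant of f and f' to one with a linear polynomial. All signs
  disappear because 4 divides n - 1.\<close>

lemma poly_disc_trinomial:
  assumes n: "n \<ge> 2" "n mod 4 = 1" and a: "a \<noteq> 0"
  shows "poly_disc (trinomial n a b) = int n ^ n * b ^ (n - 1) + int (n - 1) ^ (n - 1) * a ^ n"
proof -
  define f where "f = trinomial n a b"
  define m where "m = n - 1"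
  have nm: "n = Suc m" "m > 0" and em: "even m" using n unfolding m_def by (auto, presburger)
  define G where "G = monom (int n) m + [:a:]"
  have G: "pderiv f = G" unfolding f_def G_def m_def using n by (simp add: pderiv_trinomial)
  define c where "c = int m * a"
  define e where "e = int n * b"
  have c: "c \<noteq> 0" using a nm by (simp add: c_def)
  have df: "degree f = n" using n by (simp add: f_def degree_trinomial)
  have dG: "degree G = m" unfolding G_def using nm
    by (subst degree_add_eq_left) (auto simp: degree_monom_eq)
  have lG: "lead_coeff G = int n" unfolding dG unfolding G_def using nm by (simp add: coeff_pCons split: nat.splits)
  \<comment> \<open>This is \<open>c ^ m\<close> times the value of \<open>G\<close> at -e/c;
    evenness of \<open>m\<close> removes the sign of -e.\<close>
  define r where "r = int n * e ^ m + a * c ^ m"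
  have "[:e, c:] dvd [:0, c:] ^ m - [:-e:] ^ m"
    using minus_power_dvd_diff[of "[:0, c:]" "[:-e:]" m] by simp
  then obtain Q where Q: "[:0, c:] ^ m - [:-e:] ^ m = [:e, c:] * Q" by (elim dvdE)
  have p1: "[:0, c:] ^ m = monom (c ^ m) m"
    by (metis monom_power monom_Suc monom_0 One_nat_def mult_1)
  have p2: "[:-e:] ^ m = [:e ^ m:]" using em by (simp add: poly_const_pow)
  have "smult (c ^ m) G + smult (- int n) Q * [:e, c:] = [:r:]"
  proof -
    have eq: "smult (- int n) Q * [:e, c:] = smult (- int n) (monom (c ^ m) m - [:e ^ m:])"
      unfolding mult_smult_left using Q p1 p2 by (metis mult.commute)
    show ?thesis unfolding eq G_def r_def
      by (rule poly_eqI) (auto simp: coeff_pCons algebra_simps split: nat.splits)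
  qed
  from resultant_linear_remainder[OF this dG nm(2) c] have R1: "resultant G [:e, c:] = r" using em by simp
  have id: "smult (int n) f + [:0, -1:] * G = [:e, c:]"
    by (rule poly_eqI) (auto simp: f_def G_def trinomial_def coeff_pCons nm e_def c_def algebra_simps split: nat.splits)
  \<comment> \<open>The degree drops from \<open>n\<close> to 1, which contributes the factor
    \<open>lead_coeff G ^ (n - 1)\<close>. It cancels against the factor \<open>int n ^ m\<close>
    that comes from scaling \<open>f\<close> by \<open>n\<close>.\<close>
  have "subresultant 0 (smult (int n) f) G = smult (int n ^ m) (subresultant 0 G [:e, c:])"
  proof (cases "m = 1")
    case True then show ?thesis using em by simp
  next
    case False
    then show ?thesis using BT_lemma_1_12[OF id, of 0] c df dG lG nm em by simp
  qed
  then have "resultant (smult (int n) f) G = int n ^ m * r"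
    by (simp add: subresultant_resultant R1)
  moreover have "resultant (smult (int n) f) G = int n ^ m * resultant f G"
    using resultant_smult_left[of "int n" f G] dG nm by simp
  ultimately have "resultant f G = r" using nm by simp
  moreover have "even (n * (n - 1) div 2)"
  proof -
    have "4 dvd m" using n(2) unfolding m_def by presburger
    then obtain k where "m = 4 * k" by (elim dvdE)
    then have "n * (n - 1) = 2 * (2 * (n * k))" unfolding m_def by simp
    then show ?thesis by (metis dvd_triv_left nonzero_mult_div_cancel_left zero_neq_numeral)
  qed
  ultimately have "poly_disc f = r"
    unfolding poly_disc_def G df using lead_coeff_trinomial[OF n(1), of a b] df by (simp add: f_def)
  also have "r = int n ^ n * b ^ (n - 1) + int (n - 1) ^ (n - 1) * a ^ n"
    unfolding r_def e_def c_def power_mult_distrib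
    by (simp add: nm(1) mult.left_commute mult.assoc del: of_nat_Suc)
  finally show ?thesis unfolding f_def .
qed

section \<open>Irreducibility\<close>

text \<open>Every complex root x of \<open>g\<close> satisfies (-x)^n = a x + b. The product over
  all roots is g(0)^n on the left and (-a)^d g(-b/a) on the right, where d is the degree of
  \<open>g\<close>. Expanded, the right side is an integral form in a and b whose only term free of
  a is b^d, since \<open>g\<close> is monic.\<close>

lemma monic_factor_trinomial_cong:
  fixes g :: "int poly"
  assumes dvd: "g dvd trinomial n a b" and monic: "lead_coeff g = 1" and n: "odd n" and a: "a \<noteq> 0"
  shows "[coeff g 0 ^ n = b ^ degree g] (mod a)"
proof -
  define d where "d = degree g"
  define G :: "complex poly" where "G = map_poly of_int g"
  have dG: "degree G = d" unfolding G_def d_def by simp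
  have lG: "lead_coeff G = 1" unfolding dG using monic by (simp add: G_def d_def)
  have "G \<noteq> 0" using lG by auto
  then obtain R where R: "size R = d" "G = (\<Prod>x\<in>#R. [:-x, 1:])"
    using alg_closed_imp_factorization[of G] lG dG by auto
  have pG: "poly G y = (\<Prod>x\<in>#R. y - x)" for y
    unfolding R(2) by (simp add: poly_prod_mset image_mset.compositionality o_def)
  have root: "(-x) ^ n = of_int a * x + of_int b" if "x \<in># R" for x
  proof -
    have "poly G x = 0" unfolding pG using that by auto
    moreover have "G dvd map_poly of_int (trinomial n a b)"
      unfolding G_def using dvd by (metis of_int_poly_hom.hom_dvd)
    ultimately have "poly (map_poly of_int (trinomial n a b)) x = 0"
      by (metis dvd_def mult_zero_left poly_mult)
    then have "x ^ n + of_int a * x + of_int b = 0" by (simp add: poly_trinomial)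
    then have "- (x ^ n) = of_int a * x + of_int b" by (metis add.assoc minus_unique)
    then show ?thesis using n by simp
  qed
  have "poly G 0 ^ n = (\<Prod>x\<in>#R. (-x) ^ n)"
    unfolding pG by (induction R) (simp_all add: power_mult_distrib del: mult_minus_left)
  also have "\<dots> = (\<Prod>x\<in>#R. of_int (-a) * (- of_int b / of_int a - x))"
    by (intro arg_cong[of _ _ prod_mset] image_mset_cong) (use a in \<open>simp add: root field_simps\<close>)
  also have "\<dots> = of_int (-a) ^ d * poly G (- of_int b / of_int a)"
    unfolding pG R(1)[symmetric] by (induction R) (simp_all only: image_mset_add_mset image_mset_empty
      prod_mset.add_mset prod_mset.empty size_add_mset size_empty power_Suc power_0 mult_1 mult_ac)
  also have "\<dots> = (\<Sum>j\<le>d. of_int (-a) ^ d * (of_int (coeff g j) * (- of_int b / of_int a) ^ j))"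
    unfolding poly_altdef dG by (simp add: G_def sum_distrib_left)
  also have "\<dots> = (\<Sum>j\<le>d. of_int (coeff g j * b ^ j * (-a) ^ (d - j)))"
  proof (rule sum.cong[OF refl])
    fix j assume j: "j \<in> {..d}"
    have "complex_of_int (-a) ^ d = of_int (-a) ^ (d - j) * of_int (-a) ^ j"
      using j by (simp flip: power_add)
    moreover have "complex_of_int (-a) ^ j * (- of_int b / of_int a) ^ j = of_int b ^ j"
      unfolding power_mult_distrib[symmetric] using a by simp
    ultimately show "complex_of_int (-a) ^ d * (of_int (coeff g j) * (- of_int b / of_int a) ^ j)
        = of_int (coeff g j * b ^ j * (-a) ^ (d - j))"
      by (simp add: algebra_simps)
  qed
  finally have "complex_of_int (coeff g 0 ^ n) = of_int (\<Sum>j\<le>d. coeff g j * b ^ j * (-a) ^ (d - j))"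
    by (simp add: G_def poly_0_coeff_0)
  then have eq: "coeff g 0 ^ n = (\<Sum>j\<le>d. coeff g j * b ^ j * (-a) ^ (d - j))"
    by (simp only: of_int_eq_iff)
  have "[(\<Sum>j\<le>d. coeff g j * b ^ j * (-a) ^ (d - j)) = (\<Sum>j\<le>d. if j = d then b ^ d else 0)] (mod a)"
  proof (rule cong_sum)
    fix j assume "j \<in> {..d}"
    moreover have "a dvd (-a) ^ (d - j)" if "j < d"
      using that dvd_power[of "d - j" "-a"] by simp
    ultimately show "[coeff g j * b ^ j * (-a) ^ (d - j) = (if j = d then b ^ d else 0)] (mod a)"
      using monic by (auto simp: d_def cong_0_iff)
  qed
  then show ?thesis unfolding eq d_def[symmetric] by simp
qed

text \<open>Write q - 1 = k l. Since k divides n, the l-th power of c^n is a power of c^(q-1), hence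
  1 modulo q. So \<beta>^(d l) is 1, and the order k l of the primitive root \<beta> divides d
  l.\<close>

lemma primroot_power_eq_power_imp_dvd:
  fixes q k n d \<beta> :: nat and b c :: int
  assumes q: "prime q" and k: "k dvd q - 1" "k dvd n" and \<beta>: "residue_primroot q \<beta>"
    and b: "[b = int \<beta>] (mod int q)" and eq: "[c ^ n = b ^ d] (mod int q)" and n: "n > 0"
  shows "k dvd d"
proof -
  define \<gamma> where "\<gamma> = nat (c mod int q)"
  have q0: "q > 1" using q prime_gt_1_nat by blast
  have "[int \<gamma> = c] (mod int q)" unfolding \<gamma>_def using q0 by (simp add: cong_def)
  then have "[int \<gamma> ^ n = c ^ n] (mod int q)" by (rule cong_pow)
  also note eq
  also have "[b ^ d = int \<beta> ^ d] (mod int q)" using b by (rule cong_pow)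
  finally have "[int (\<gamma> ^ n) = int (\<beta> ^ d)] (mod int q)" by simp
  then have eq': "[\<gamma> ^ n = \<beta> ^ d] (mod q)" by (simp only: cong_int_iff)
  have ord: "ord q \<beta> = q - 1" and cop: "Rings.coprime q \<beta>"
    using \<beta> q unfolding residue_primroot_def by (auto simp: totient_prime)
  have "Rings.coprime (\<beta> ^ d) q" using cop by (simp add: algebraic_semidom_class.coprime_commute)
  then have "Rings.coprime (\<gamma> ^ n) q" using eq' cong_imp_coprime cong_sym by blast
  then have cg: "Rings.coprime \<gamma> q" using n by simp
  obtain l where l: "q - 1 = k * l" using k by (elim dvdE)
  obtain m where m: "n = k * m" using k by (elim dvdE)
  have "[\<gamma> ^ (q - 1) = 1] (mod q)" using cg euler_theorem[of \<gamma> q] q by (simp add: totient_prime)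
  then have "[(\<gamma> ^ (q - 1)) ^ m = 1] (mod q)" using cong_pow by fastforce
  moreover have "(\<gamma> ^ (q - 1)) ^ m = (\<gamma> ^ n) ^ l" unfolding l m by (simp add: ac_simps flip: power_mult)
  ultimately have "[(\<beta> ^ d) ^ l = 1] (mod q)"
    using cong_trans[OF cong_sym[OF cong_pow[OF eq', of l]]] by simp
  then have "ord q \<beta> dvd d * l" by (simp only: ord_divides flip: power_mult)
  then have "k * l dvd d * l" unfolding ord l .
  moreover have "l > 0" using l q0 by (cases l) auto
  ultimately show ?thesis by simp
qed

text \<open>For each prime power p^e exactly dividing n, a prime q dividing a with p^e dividing q -
  1 forces p^e to divide the degree of every monic factor. Together these give n, so a factor of
  degree strictly between 0 and n cannot exist.\<close>

lemma irreducible_trinomial: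
  fixes a b :: int
  assumes n: "odd n" "n \<ge> 2" and a: "a \<noteq> 0"
    and H: "\<And>p. prime p \<Longrightarrow> p dvd n \<Longrightarrow> \<exists>q \<beta>. prime q \<and> int q dvd a \<and>
        p ^ multiplicity p n dvd q - 1 \<and> residue_primroot q \<beta> \<and> [b = int \<beta>] (mod int q)"
  shows "irreducible (map_poly rat_of_int (trinomial n a b))"
proof -
  let ?f = "trinomial n a b"
  have no: "n dvd degree g" if dvd: "g dvd ?f" and l: "lead_coeff g = 1" for g
  proof (cases "degree g = 0")
    case False
    show ?thesis
    proof (rule multiplicity_le_imp_dvd)
      show "n \<noteq> 0" using n by auto
      fix p :: nat assume p: "prime p"
      have "p ^ multiplicity p n dvd degree g"
      proof (cases "p dvd n")
        case True
        then obtain q \<beta> where q: "prime q" "int q dvd a" "p ^ multiplicity p n dvd q - 1"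
          "residue_primroot q \<beta>" "[b = int \<beta>] (mod int q)" using H[OF p] by blast
        have "[coeff g 0 ^ n = b ^ degree g] (mod int q)"
          using monic_factor_trinomial_cong[OF dvd l n(1) a] q(2) cong_dvd_modulus by blast
        then show ?thesis
          using primroot_power_eq_power_imp_dvd[OF q(1,3) multiplicity_dvd q(4,5)] n by simp
      qed (simp add: not_dvd_imp_multiplicity_0)
      then show "multiplicity p n \<le> multiplicity p (degree g)"
        using p False by (intro multiplicity_geI) auto
    qed
  qed simp
  have "irreducible\<^sub>d ?f"
  proof (rule irreducible\<^sub>dI)
    show "degree ?f > 0" using n by (simp add: degree_trinomial)
    fix g h assume gh: "degree g > 0" "degree g < degree ?f" "?f = g * h"
    have "lead_coeff g * lead_coeff h = 1"
      using lead_coeff_trinomial[OF n(2), of a b] unfolding gh(3) lead_coeff_mult .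
    then have "lead_coeff g = 1 \<or> lead_coeff g = -1" using zmult_eq_1_iff by auto
    then have "n dvd degree g"
    proof
      assume "lead_coeff g = 1" then show ?thesis using no[of g] gh by simp
    next
      assume "lead_coeff g = -1"
      then have "n dvd degree (-g)" using no[of "-g"] gh by simp
      then show ?thesis by simp
    qed
    moreover have "degree g < n" using gh(2) degree_trinomial[OF n(2), of a b] by simp
    ultimately show False using gh(1) nat_dvd_not_less by blast
  qed
  then show ?thesis using irreducible\<^sub>d_int_rat by (simp add: irreducible_connect_field)
qed

text \<open>
  The witness \<open>q\<close> is a prime factor of \<open>(n^(p^e) - 1) / (n^(p^(e-1)) - 1)\<close>, so that \<open>n\<close> has order
  exactly \<open>p^e\<close> modulo \<open>q\<close>.
\<close>

lemma prime_power_dvd_prime_minus_1: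
  fixes n p e :: nat
  assumes p: "prime p" and pn: "p dvd n" and n: "n > 0" and e: "e > 0"
  shows "\<exists>q. prime q \<and> \<not> q dvd n \<and> p ^ e dvd q - 1"
proof -
  define y where "y = n ^ (p ^ (e - 1))"
  define S where "S = (\<Sum>i<p. y ^ i)"
  have p2: "p \<ge> 2" using p prime_ge_2_nat by blast
  have y2: "y \<ge> 2"
  proof -
    have "n \<ge> 2" using pn n p2 by (meson dvd_imp_le order_trans)
    moreover have "n ^ 1 \<le> y" unfolding y_def using n p by (intro power_increasing) (auto simp: Suc_le_eq prime_gt_0_nat)
    ultimately show ?thesis by simp
  qed
  \<comment> \<open>\<open>S\<close> is 1 modulo \<open>y\<close>, so no prime factor of
    \<open>S\<close> divides \<open>n\<close>.\<close>
  have Sy: "S = 1 + y * (\<Sum>i<p - 1. y ^ i)"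
    unfolding S_def using p2 by (cases p) (auto simp: sum.lessThan_Suc_shift sum_distrib_left simp del: sum.lessThan_Suc)
  have "(\<Sum>i<p - 1. y ^ i) > 0" using p2 y2 by (intro sum_pos) (auto simp: lessThan_empty_iff)
  then have "y * (\<Sum>i<p - 1. y ^ i) > 0" using y2 by (intro mult_pos_pos) auto
  then have "S \<noteq> 1" using Sy by linarith
  then obtain q where q: "prime q" "q dvd S" using prime_factor_nat by blast
  have qn: "\<not> q dvd n"
  proof
    assume "q dvd n"
    then have "q dvd y" unfolding y_def using p by (intro dvd_power_le[of q n 1, simplified]) (use prime_gt_0_nat[OF p] in \<open>simp_all add: Suc_le_eq\<close>)
    then have "q dvd 1" using q(2) Sy by (metis dvd_add_left_iff dvd_mult2)
    then show False using q(1) by auto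
  qed
  have yp: "[y ^ p = 1] (mod q)"
  proof -
    have "int y ^ p - 1 = (int y - 1) * int S" unfolding S_def by (simp add: power_diff_1_eq)
    then have "[int y ^ p = 1] (mod int q)" using q(2) by (simp add: cong_iff_dvd_diff)
    then have "[int (y ^ p) = int 1] (mod int q)" by simp
    then show ?thesis by (simp only: cong_int_iff)
  qed
  \<comment> \<open>If \<open>y\<close> were 1 modulo \<open>q\<close>, then \<open>S\<close> would
    be congruent to \<open>p\<close>, and \<open>q\<close> would divide \<open>p\<close> and hence
    \<open>n\<close>. This excludes every order smaller than p^e.\<close>
  have y1: "\<not> [y = 1] (mod q)"
  proof
    assume "[y = 1] (mod q)"
    then have "[S = (\<Sum>i<p. 1 ^ i)] (mod q)" unfolding S_def by (intro cong_sum cong_pow)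
    then have "[S = p] (mod q)" by simp
    then have "q dvd p" using q(2) by (metis cong_dvd_iff)
    then show False using qn pn dvd_trans by blast
  qed
  have ee: "p ^ e = p ^ (e - 1) * p" using e by (metis Suc_diff_1 power_Suc2)
  have "ord q n dvd p ^ e" unfolding ord_divides[symmetric] ee using yp by (simp add: y_def power_mult)
  then obtain i where i: "i \<le> e" "ord q n = p ^ i" using divides_primepow_nat[OF p] by blast
  have "\<not> ord q n dvd p ^ (e - 1)" unfolding ord_divides[symmetric] using y1 by (simp add: y_def)
  then have "i = e" using i le_imp_power_dvd by (metis Suc_diff_1 e le_SucE)
  moreover have "ord q n dvd totient q" using order_divides_totient[of q n] qn q(1)
    by (simp add: prime_imp_coprime coprime_commute)
  ultimately show ?thesis using q qn i by (auto simp: totient_prime)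
qed

section \<open>Large square factors\<close>

lemma rad_pos: "rad m > 0"
  unfolding rad_def by (intro prod_pos) (auto simp: prime_factors_gt_0_nat)

lemma rad_mult_le:
  assumes "x > 0" "y > 0"
  shows "rad (x * y) \<le> rad x * rad y"
proof -
  let ?P = "prime_factors x" and ?Q = "prime_factors y"
  have pos: "\<Prod>(?P \<inter> ?Q) > 0" by (auto intro!: prod_pos prime_factors_gt_0_nat)
  have "rad (x * y) = \<Prod>(?P \<union> ?Q)" unfolding rad_def using assms by (simp add: prime_factors_product)
  also have "\<dots> \<le> \<Prod>(?P \<union> ?Q) * \<Prod>(?P \<inter> ?Q)" using pos by (cases "\<Prod>(?P \<inter> ?Q)") simp_all
  also have "\<dots> = rad x * rad y" unfolding rad_def by (rule prod.union_inter) auto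
  finally show ?thesis .
qed

lemma rad_power: "k > 0 \<Longrightarrow> rad (x ^ k) = rad x"
  unfolding rad_def by (simp add: prime_factors_power)

lemma rad_le:
  assumes "x > 0"
  shows "rad x \<le> x"
proof -
  have "rad x dvd (\<Prod>p\<in>prime_factors x. p ^ multiplicity p x)"
    unfolding rad_def by (rule prod_dvd_prod)
      (auto simp: prime_factors_multiplicity intro!: dvd_power)
  also have "\<dots> = x" using assms prod_prime_factors[of x] by simp
  finally show ?thesis using assms by (rule dvd_imp_le)
qed

text \<open>Dividing x by p leaves its set of prime factors unchanged, since p still divides the
  quotient. Hence the radical is at most x / p.\<close>

lemma prime_mult_rad_le:
  assumes "prime p" "p ^ 2 dvd x" "x > 0"
  shows "p * rad x \<le> x"
proof -
  obtain y where y: "x = p * (p * y)" using assms(2) by (metis dvdE power2_eq_square mult.assoc)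
  have "y > 0" "p > 0" using assms y by (auto intro: Nat.gr0I)
  then have "prime_factors x = prime_factors (p * y)"
    unfolding y using assms(1) by (auto simp: prime_factors_product prime_prime_factors)
  then have "rad x = rad (p * y)" unfolding rad_def by simp
  also have "\<dots> \<le> p * y" using \<open>y > 0\<close> \<open>p > 0\<close> by (intro rad_le) simp
  finally show ?thesis unfolding y by simp
qed

text \<open>Solves the abc inequality for P, the product of the two primes. Cancelling X leaves
  (P/R)^(1+\<epsilon>) \<le> C X^\<epsilon>. If P > R, the exponent on the left may be lowered to 1;
  otherwise the claim follows from C X^\<epsilon> \<ge> 1.\<close>

lemma le_of_le_power_one_plus:
  fixes X C R P \<epsilon> :: real
  assumes le: "X \<le> C * (R * X / P) powr (1 + \<epsilon>)" and X: "X \<ge> 1" and C: "C \<ge> 1" and R: "R > 0" and P: "P > 0"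
    and \<epsilon>: "\<epsilon> > 0"
  shows "P \<le> R * C * X powr \<epsilon>"
proof (cases "P \<le> R")
  case True
  have "1 \<le> X powr \<epsilon>" using X \<epsilon> by (intro ge_one_powr_ge_zero) auto
  then have "1 * 1 \<le> C * X powr \<epsilon>" using C by (intro mult_mono) auto
  then have "R * (1 * 1) \<le> R * (C * X powr \<epsilon>)" using R by (intro mult_left_mono) auto
  then show ?thesis using True by (simp add: mult.assoc)
next
  case False
  have "(R * X / P) powr (1 + \<epsilon>) = X * X powr \<epsilon> * (P / R) powr (- (1 + \<epsilon>))"
  proof -
    have "R * X / P = X * (P / R) powr (-1)" using R P by (simp add: powr_minus_divide)
    then have "(R * X / P) powr (1 + \<epsilon>) = X powr (1 + \<epsilon>) * ((P / R) powr (-1)) powr (1 + \<epsilon>)"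
      using X R P by (simp only: powr_mult)
    also have "X powr (1 + \<epsilon>) = X * X powr \<epsilon>" using X by (simp add: powr_add)
    also have "((P / R) powr (-1)) powr (1 + \<epsilon>) = (P / R) powr (- (1 + \<epsilon>))" unfolding powr_powr by simp
    finally show ?thesis .
  qed
  then have "X \<le> X * (C * X powr \<epsilon> * (P / R) powr (- (1 + \<epsilon>)))" using le by (simp add: mult_ac)
  then have "1 \<le> C * X powr \<epsilon> * (P / R) powr (- (1 + \<epsilon>))" using X by simp
  then have "(P / R) powr (1 + \<epsilon>) \<le> C * X powr \<epsilon>"
    unfolding powr_minus using R P by (simp add: field_simps)
  moreover have "(P / R) powr 1 \<le> (P / R) powr (1 + \<epsilon>)"
    using False R \<epsilon> by (intro powr_mono) auto
  ultimately have "P / R \<le> C * X powr \<epsilon>" using P R by simp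
  then show ?thesis using R by (simp add: field_simps)
qed

text \<open>The abc conjecture for \<open>v^2 + (u + v) (u - v) = u^2\<close>.\<close>

lemma abc_square_factors_bound:
  assumes abc: abc_conjecture and \<epsilon>: "\<epsilon> > 0"
  shows "\<exists>C\<ge>1. \<forall>u v p\<^sub>1 p\<^sub>2 :: nat. 0 < v \<and> v < u \<and> Rings.coprime u v
     \<and> prime p\<^sub>1 \<and> prime p\<^sub>2 \<and> p\<^sub>1\<^sup>2 dvd u + v \<and> p\<^sub>2\<^sup>2 dvd u - v \<longrightarrow>
     real p\<^sub>1 * real p\<^sub>2 \<le> real (rad u) * real (rad v) * C * (real u ^ 2) powr \<epsilon>"
proof -
  obtain C0 where C0: "\<forall>a b c :: nat. a > 0 \<and> b > 0 \<and> c > 0 \<and> Rings.coprime a b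
      \<and> Rings.coprime a c \<and> Rings.coprime b c \<and> a + b = c
        \<longrightarrow> real c \<le> C0 * real (rad (a * b * c)) powr (1 + \<epsilon>)"
    using mp[OF spec[OF abc[unfolded abc_conjecture_def]] \<epsilon>] by blast
  define C where "C = max C0 1"
  have "real p\<^sub>1 * real p\<^sub>2 \<le> real (rad u) * real (rad v) * C * (real u ^ 2) powr \<epsilon>"
    if v: "0 < v" "v < u" and cop: "Rings.coprime u v" and p: "prime p\<^sub>1" "prime p\<^sub>2"
      and d: "p\<^sub>1\<^sup>2 dvd u + v" "p\<^sub>2\<^sup>2 dvd u - v" for u v p\<^sub>1 p\<^sub>2 :: nat
  proof (rule le_of_le_power_one_plus)
    define y where "y = (u + v) * (u - v)"
    have y0: "y > 0" using v by (simp add: y_def)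
    have yeq: "v ^ 2 + y = u ^ 2"
    proof -
      obtain k where k: "u = v + k" using v less_imp_add_positive by blast
      show ?thesis unfolding y_def k by (simp add: algebra_simps power2_eq_square)
    qed
    have c1: "Rings.coprime (v ^ 2) (u ^ 2)"
      using cop by (simp add: algebraic_semidom_class.coprime_commute)
    \<comment> \<open>Since u^2 = v^2 + y, all three pairwise gcds in the abc triple agree.\<close>
    have "gcd (v ^ 2) (u ^ 2) = 1" using c1 by (rule coprime_imp_gcd_eq_1)
    then have g: "gcd (v ^ 2) y = 1"
      using gcd_add2[of "v ^ 2" y] unfolding yeq by (simp only:)
    have c2: "Rings.coprime (v ^ 2) y" using g by (rule gcd_eq_1_imp_coprime)
    have "gcd y (u ^ 2) = 1"
      using g gcd_add1[of "v ^ 2" y] unfolding yeq gcd.commute[of y] by (simp only:)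
    then have c3: "Rings.coprime y (u ^ 2)" by (rule gcd_eq_1_imp_coprime)
    have "real (u ^ 2) \<le> C0 * real (rad (v ^ 2 * y * u ^ 2)) powr (1 + \<epsilon>)"
      using v y0 yeq c1 c2 c3 by (intro C0[rule_format]) simp
    also have "\<dots> \<le> C * real (rad (v ^ 2 * y * u ^ 2)) powr (1 + \<epsilon>)"
      unfolding C_def by (intro mult_right_mono) auto
    \<comment> \<open>Squares do not affect the radical, and each of u + v and u - v loses one prime
      by its square factor. What remains is bounded by (u + v)(u - v) \<le> u^2 divided by the two
      primes.\<close>
    also have "\<dots> \<le> C * (real (rad u) * real (rad v) * real u ^ 2 / (real p\<^sub>1 * real p\<^sub>2)) powr (1 + \<epsilon>)"
    proof (intro mult_left_mono powr_mono2)
      have pp: "p\<^sub>1 > 0" "p\<^sub>2 > 0" using p prime_gt_0_nat by auto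
      have "rad (v ^ 2 * y * u ^ 2) \<le> rad (v ^ 2 * y) * rad (u ^ 2)" using v y0 by (intro rad_mult_le) auto
      also have "\<dots> \<le> (rad (v ^ 2) * rad y) * rad (u ^ 2)" using v y0 by (intro mult_right_mono rad_mult_le) auto
      also have "\<dots> \<le> (rad (v ^ 2) * (rad (u + v) * rad (u - v))) * rad (u ^ 2)"
        unfolding y_def using v by (intro mult_right_mono mult_left_mono rad_mult_le) auto
      also have "\<dots> = rad u * rad v * (rad (u + v) * rad (u - v))" by (simp add: rad_power)
      finally have r1: "rad (v ^ 2 * y * u ^ 2) \<le> rad u * rad v * (rad (u + v) * rad (u - v))" .
      have "(p\<^sub>1 * p\<^sub>2) * rad (v ^ 2 * y * u ^ 2) \<le> (p\<^sub>1 * p\<^sub>2) * (rad u * rad v * (rad (u + v) * rad (u - v)))"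
        using r1 by (rule mult_left_mono) simp
      also have "\<dots> = rad u * rad v * ((p\<^sub>1 * rad (u + v)) * (p\<^sub>2 * rad (u - v)))" by (simp add: mult_ac)
      also have "\<dots> \<le> rad u * rad v * ((u + v) * (u - v))"
        using v p d by (intro mult_left_mono mult_mono prime_mult_rad_le) auto
      also have "\<dots> \<le> rad u * rad v * u ^ 2"
        using yeq unfolding y_def[symmetric] by (intro mult_left_mono) auto
      finally have "real ((p\<^sub>1 * p\<^sub>2) * rad (v ^ 2 * y * u ^ 2)) \<le> real (rad u * rad v * u ^ 2)"
        by (rule of_nat_mono)
      then show "real (rad (v ^ 2 * y * u ^ 2)) \<le> real (rad u) * real (rad v) * real u ^ 2 / (real p\<^sub>1 * real p\<^sub>2)"
        using pp by (simp add: field_simps)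
    qed (use \<epsilon> in \<open>auto simp: C_def\<close>)
    finally show "real u ^ 2 \<le> C * (real (rad u) * real (rad v) * real u ^ 2 / (real p\<^sub>1 * real p\<^sub>2)) powr (1 + \<epsilon>)"
      by simp
    show "real u ^ 2 \<ge> 1" using v by simp
    show "C \<ge> 1" by (simp add: C_def)
    show "real (rad u) * real (rad v) > 0" by (simp add: rad_pos)
    show "real p\<^sub>1 * real p\<^sub>2 > 0" using p by (simp add: prime_gt_0_nat)
  qed (use \<epsilon> in auto)
  moreover have "C \<ge> 1" by (simp add: C_def)
  ultimately show ?thesis by blast
qed

text \<open>The closed form found in \<open>poly_disc_trinomial\<close>, detached from resultants so
  that the arithmetic below can work with it directly.\<close>

definition trinomial_disc :: "nat \<Rightarrow> int \<Rightarrow> int \<Rightarrow> int" where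
  "trinomial_disc n a b = int n ^ n * b ^ (n - 1) + int (n - 1) ^ (n - 1) * a ^ n"

lemma int_square_dvd_int_iff: "(int p)\<^sup>2 dvd int m \<longleftrightarrow> p\<^sup>2 dvd m"
  using of_nat_dvd_iff[of "p\<^sup>2" m, where 'a = int] by simp

text \<open>The product of two such primes exceeds B^2 / K^2. The abc bound is at most a constant
  times A B^(1+\<eta>/2), and A \<le> B^(1-\<eta>) turns this into a constant times B^(2-\<eta>/2),
  a contradiction for large B.\<close>

lemma no_two_large_square_factors:
  fixes K \<delta> :: real
  assumes abc: abc_conjecture and n: "odd n" "n \<ge> 2" and \<delta>: "\<delta> > 0" and K: "K > 0"
  shows "\<exists>B\<^sub>0. \<forall>(a::int) (b::int) (A::real) (B::real) (p\<^sub>1::nat) (p\<^sub>2::nat).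
      1 \<le> A \<longrightarrow> A powr (1 + \<delta>) < B \<longrightarrow> B\<^sub>0 \<le> B \<longrightarrow> 0 < a \<longrightarrow> a \<le> 2 * A \<longrightarrow> 0 < b \<longrightarrow> b \<le> 2 * B \<longrightarrow>
      Rings.coprime (int n * b) (int (n - 1) * a) \<longrightarrow> prime p\<^sub>1 \<longrightarrow> prime p\<^sub>2 \<longrightarrow>
      B / K < p\<^sub>1 \<longrightarrow> B / K < p\<^sub>2 \<longrightarrow> (int p\<^sub>1)\<^sup>2 dvd trinomial_disc n a b \<longrightarrow>
      \<not> (int p\<^sub>2)\<^sup>2 dvd trinomial_disc n (- a) b"
proof -
  \<comment> \<open>The saving in the exponent: A^(1+\<delta>) < B says that A <
    B^(1-\<eta>).\<close>
  define \<eta> where "\<eta> = 1 - 1 / (1 + \<delta>)"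
  have \<eta>: "\<eta> > 0" using \<delta> by (simp add: \<eta>_def field_simps)
  \<comment> \<open>As u and v are at most (2 n B)^n, this makes (u^2)^\<epsilon> at most (2 n
    B)^(\<eta>/2), which costs only half of the saving.\<close>
  define \<epsilon> where "\<epsilon> = \<eta> / (4 * n)"
  have \<epsilon>: "\<epsilon> > 0" using \<eta> n by (simp add: \<epsilon>_def)
  obtain C where C: "C \<ge> 1" and bound: "\<And>u v p\<^sub>1 p\<^sub>2 :: nat. 0 < v \<Longrightarrow> v < u \<Longrightarrow> Rings.coprime u v
     \<Longrightarrow> prime p\<^sub>1 \<Longrightarrow> prime p\<^sub>2 \<Longrightarrow> p\<^sub>1\<^sup>2 dvd u + v \<Longrightarrow> p\<^sub>2\<^sup>2 dvd u - v \<Longrightarrow>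
     real p\<^sub>1 * real p\<^sub>2 \<le> real (rad u) * real (rad v) * C * (real u ^ 2) powr \<epsilon>"
    using abc_square_factors_bound[OF abc \<epsilon>] by (elim exE conjE) (simp only: simp_thms)
  define K' where "K' = K\<^sup>2 * (4 * real n ^ 2 * C * (2 * n) powr (\<eta> / 2))"
  have K': "K' > 0" unfolding K'_def using K C n by simp
  \<comment> \<open>Beyond this point B^(\<eta>/2) is at least \<open>K'\<close>, which collects all
    constants.\<close>
  define B\<^sub>0 where "B\<^sub>0 = max 1 (K' powr (2 / \<eta>))"
  have False
    if A: "1 \<le> A" and AB: "A powr (1 + \<delta>) < B" and B0: "B\<^sub>0 \<le> B" and a: "0 < a" "a \<le> 2 * A"
      and b: "0 < b" "b \<le> 2 * B" and cop: "Rings.coprime (int n * b) (int (n - 1) * a)"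
      and p: "prime p\<^sub>1" "prime p\<^sub>2" "B / K < p\<^sub>1" "B / K < p\<^sub>2"
      and d1: "(int p\<^sub>1)\<^sup>2 dvd trinomial_disc n a b" and d2: "(int p\<^sub>2)\<^sup>2 dvd trinomial_disc n (- a) b"
    for a b :: int and A B :: real and p\<^sub>1 p\<^sub>2 :: nat
  proof -
    define \<alpha> where "\<alpha> = nat a"
    define \<beta> where "\<beta> = nat b"
    have \<alpha>: "a = int \<alpha>" "\<alpha> > 0" and \<beta>: "b = int \<beta>" "\<beta> > 0" using a b by (auto simp: \<alpha>_def \<beta>_def)
    define u where "u = n ^ n * \<beta> ^ (n - 1)"
    define v where "v = (n - 1) ^ (n - 1) * \<alpha> ^ n"
    have D1: "trinomial_disc n a b = int (u + v)"
      unfolding trinomial_disc_def u_def v_def \<alpha> \<beta> by simp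
    have D2: "trinomial_disc n (- a) b = int u - int v"
      unfolding trinomial_disc_def u_def v_def \<alpha> \<beta> using n by simp
    have n1: "n - 1 > 0" using n by simp
    have pos: "u > 0" "v > 0" unfolding u_def v_def using n \<alpha> \<beta> by auto
    have B1: "B \<ge> 1" using B0 by (simp add: B\<^sub>0_def)
    have "A = A powr 1" using A by simp
    also have "\<dots> \<le> A powr (1 + \<delta>)" using A \<delta> by (intro powr_mono) auto
    finally have AleB: "A \<le> B" using AB by simp
    have A': "A \<le> B powr (1 - \<eta>)"
    proof -
      have "A = (A powr (1 + \<delta>)) powr (1 - \<eta>)" using A \<delta> by (simp add: powr_powr \<eta>_def)
      also have "\<dots> \<le> B powr (1 - \<eta>)" using AB \<delta> by (intro powr_mono2) (auto simp: \<eta>_def)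
      finally show ?thesis .
    qed
    have "Rings.coprime (n * \<beta>) ((n - 1) * \<alpha>)"
      using cop unfolding \<alpha> \<beta> by (simp only: coprime_int_iff flip: of_nat_mult)
    then have cop': "Rings.coprime ((n * \<beta>) ^ n) (((n - 1) * \<alpha>) ^ n)" by simp
    have "u dvd (n * \<beta>) ^ n"
      unfolding u_def power_mult_distrib by (intro mult_dvd_mono le_imp_power_dvd) auto
    moreover have "v dvd ((n - 1) * \<alpha>) ^ n"
      unfolding v_def power_mult_distrib by (intro mult_dvd_mono le_imp_power_dvd) auto
    ultimately have cuv: "Rings.coprime u v"
      using cop' by (rule coprime_divisors)
    \<comment> \<open>Coprime numbers can only be equal if both are 1; this excludes a zero
      difference u - v.\<close>
    have "u \<noteq> 1" unfolding u_def using n by auto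
    then have neq: "u \<noteq> v" using cuv by auto
    have ru: "real (rad u) \<le> n * (2 * B)"
    proof -
      have "rad u \<le> rad (n ^ n) * rad (\<beta> ^ (n - 1))" unfolding u_def using n \<beta> by (intro rad_mult_le) auto
      also have "\<dots> = rad n * rad \<beta>" using n by (simp add: rad_power)
      also have "\<dots> \<le> n * \<beta>" using n \<beta> by (intro mult_mono rad_le) auto
      finally have "real (rad u) \<le> real (n * \<beta>)" by (rule of_nat_mono)
      also have "\<dots> \<le> n * (2 * B)" unfolding of_nat_mult using b \<beta> by (intro mult_left_mono) auto
      finally show ?thesis .
    qed
    have rv: "real (rad v) \<le> n * (2 * A)"
    proof -
      have "rad v \<le> rad ((n - 1) ^ (n - 1)) * rad (\<alpha> ^ n)" unfolding v_def using n \<alpha> by (intro rad_mult_le) auto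
      also have "\<dots> = rad (n - 1) * rad \<alpha>" using n by (simp add: rad_power)
      also have "\<dots> \<le> (n - 1) * \<alpha>" using n \<alpha> by (intro mult_mono rad_le) auto
      also have "\<dots> \<le> n * \<alpha>" by simp
      finally have "real (rad v) \<le> real (n * \<alpha>)" by (rule of_nat_mono)
      also have "\<dots> \<le> n * (2 * A)" unfolding of_nat_mult using a \<alpha> by (intro mult_left_mono) auto
      finally show ?thesis .
    qed
    have ub: "real u \<le> (2 * n * B) ^ n"
    proof -
      have "real u = real n ^ n * real \<beta> ^ (n - 1)" by (simp add: u_def)
      also have "\<dots> \<le> real n ^ n * real \<beta> ^ n"
        using \<beta> by (intro mult_left_mono power_increasing) auto
      also have "\<dots> \<le> real n ^ n * (2 * B) ^ n" using b \<beta> by (intro mult_left_mono power_mono) auto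
      finally show ?thesis by (simp add: power_mult_distrib mult_ac)
    qed
    have vb: "real v \<le> (2 * n * B) ^ n"
    proof -
      have "real v = real (n - 1) ^ (n - 1) * real \<alpha> ^ n" by (simp add: v_def)
      also have "\<dots> \<le> real n ^ (n - 1) * real \<alpha> ^ n" by (intro mult_right_mono power_mono) auto
      also have "\<dots> \<le> real n ^ n * real \<alpha> ^ n"
        using n by (intro mult_right_mono power_increasing) auto
      also have "\<dots> \<le> real n ^ n * (2 * B) ^ n" using a \<alpha> AleB by (intro mult_left_mono power_mono) auto
      finally show ?thesis by (simp add: power_mult_distrib mult_ac)
    qed
    have pw: "(real w ^ 2) powr \<epsilon> \<le> (2 * n) powr (\<eta> / 2) * B powr (\<eta> / 2)" if w: "real w \<le> (2 * n * B) ^ n" for w :: nat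
    proof -
      have pos: "2 * n * B > 0" using n B1 by auto
      have "real w ^ 2 \<le> ((2 * n * B) ^ n) ^ 2" using w by (intro power_mono) auto
      also have "\<dots> = (2 * n * B) powr (2 * n)"
        using powr_realpow[OF pos, of "n * 2"] by (simp add: mult.commute power_mult)
      finally have "(real w ^ 2) powr \<epsilon> \<le> ((2 * n * B) powr (2 * n)) powr \<epsilon>"
        using \<epsilon> by (intro powr_mono2) auto
      also have "\<dots> = (2 * n * B) powr (\<eta> / 2)" using n by (simp add: powr_powr \<epsilon>_def)
      also have "\<dots> = (2 * n) powr (\<eta> / 2) * B powr (\<eta> / 2)" by (rule powr_mult)
      finally show ?thesis .
    qed
    \<comment> \<open>The difference u - v may have either sign; in the negative case the roles of u
      and v are exchanged.\<close>
    have main: "real p\<^sub>1 * real p\<^sub>2 \<le> real (rad u) * real (rad v) * C * ((2 * n) powr (\<eta> / 2) * B powr (\<eta> / 2))"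
    proof (cases "v < u")
      case True
      have "(int p\<^sub>2)\<^sup>2 dvd int (u - v)" using d2 unfolding D2 using True by (simp add: of_nat_diff)
      then have "p\<^sub>2\<^sup>2 dvd u - v" by (simp only: int_square_dvd_int_iff)
      moreover have "p\<^sub>1\<^sup>2 dvd u + v" using d1 unfolding D1 by (simp only: int_square_dvd_int_iff)
      ultimately have "real p\<^sub>1 * real p\<^sub>2 \<le> real (rad u) * real (rad v) * C * (real u ^ 2) powr \<epsilon>"
        using bound[OF pos(2) True cuv p(1,2)] by blast
      also have "\<dots> \<le> real (rad u) * real (rad v) * C * ((2 * n) powr (\<eta> / 2) * B powr (\<eta> / 2))"
        using C pw[OF ub] by (intro mult_left_mono) auto
      finally show ?thesis .
    next
      case False
      then have less: "u < v" using neq by simp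
      have "(int p\<^sub>2)\<^sup>2 dvd int (v - u)" using d2 unfolding D2 using less
        by (simp add: of_nat_diff dvd_diff_commute)
      then have "p\<^sub>2\<^sup>2 dvd v - u" by (simp only: int_square_dvd_int_iff)
      moreover have "p\<^sub>1\<^sup>2 dvd v + u"
        using d1 unfolding D1 by (simp only: int_square_dvd_int_iff add.commute)
      moreover have "Rings.coprime v u"
        using cuv by (simp add: algebraic_semidom_class.coprime_commute)
      ultimately have "real p\<^sub>1 * real p\<^sub>2 \<le> real (rad v) * real (rad u) * C * (real v ^ 2) powr \<epsilon>"
        using bound[OF pos(1) less _ p(1,2)] by blast
      also have "\<dots> \<le> real (rad v) * real (rad u) * C * ((2 * n) powr (\<eta> / 2) * B powr (\<eta> / 2))"
        using C pw[OF vb] by (intro mult_left_mono) auto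
      finally show ?thesis by (simp add: mult_ac)
    qed
    also have "\<dots> \<le> (n * (2 * B)) * (n * (2 * B powr (1 - \<eta>))) * C * ((2 * n) powr (\<eta> / 2) * B powr (\<eta> / 2))"
    proof -
      have "n * (2 * A) \<le> n * (2 * B powr (1 - \<eta>))" using A' by (intro mult_left_mono) auto
      with rv have "real (rad v) \<le> n * (2 * B powr (1 - \<eta>))" by (rule order_trans)
      then show ?thesis using ru C B1 by (intro mult_right_mono mult_mono) simp_all
    qed
    also have "\<dots> = K' / K\<^sup>2 * (B * B powr (1 - \<eta>) * B powr (\<eta> / 2))"
      unfolding K'_def using K by (simp add: power2_eq_square)
    also have "B * B powr (1 - \<eta>) * B powr (\<eta> / 2) = B powr 1 * B powr (1 - \<eta>) * B powr (\<eta> / 2)"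
      using B1 by simp
    also have "\<dots> = B powr (2 - \<eta> / 2)"
      unfolding powr_add[symmetric] by (rule arg_cong[of _ _ "(powr) B"]) simp
    finally have le: "real p\<^sub>1 * real p\<^sub>2 \<le> K' / K\<^sup>2 * B powr (2 - \<eta> / 2)" .
    have "B / K * (B / K) < real p\<^sub>1 * real p\<^sub>2" using p B1 K by (intro mult_strict_mono) (auto simp: prime_gt_0_nat)
    with le have "B\<^sup>2 / K\<^sup>2 < K' / K\<^sup>2 * B powr (2 - \<eta> / 2)" by (simp add: power2_eq_square)
    then have "B\<^sup>2 < K' * B powr (2 - \<eta> / 2)" using K by (simp add: field_simps)
    moreover have "B\<^sup>2 = B powr (\<eta> / 2) * B powr (2 - \<eta> / 2)"
      using B1 by (simp flip: powr_add)
    ultimately have lt: "B powr (\<eta> / 2) < K'" using B1 by simp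
    have "K' = (K' powr (2 / \<eta>)) powr (\<eta> / 2)" using K' \<eta> by (simp add: powr_powr)
    also have "\<dots> \<le> B powr (\<eta> / 2)" using B0 \<eta> by (intro powr_mono2) (auto simp: B\<^sub>0_def)
    finally show False using lt by simp
  qed
  then show ?thesis by (intro exI[of _ B\<^sub>0]) blast
qed

section \<open>Sieving by squares of medium primes\<close>

lemma card_pairwise_cong_le:
  fixes S :: "int set" and X Y M :: int
  assumes S: "S \<subseteq> {X..Y}" and M: "M > 0" and XY: "X \<le> Y"
    and cong: "\<And>x y. x \<in> S \<Longrightarrow> y \<in> S \<Longrightarrow> [x = y] (mod M)"
  shows "real (card S) \<le> real_of_int (Y - X) / M + 1"
proof -
  show ?thesis
  proof (cases "S = {}")
    case True then show ?thesis using M XY by simp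
  next
    case False
    then obtain r where r: "r \<in> S" by blast
    have "S \<subseteq> (\<lambda>k. r + M * k) ` {\<lceil>real_of_int (X - r) / M\<rceil>..\<lfloor>real_of_int (Y - r) / M\<rfloor>}"
    proof
      fix x assume x: "x \<in> S"
      then have "M dvd x - r" using cong[OF x r] by (simp add: cong_iff_dvd_diff)
      then obtain k where k: "x - r = M * k" by (elim dvdE)
      have "X \<le> x" "x \<le> Y" using x S by auto
      then have "X - r \<le> M * k" "M * k \<le> Y - r" using k by auto
      then have "real_of_int (X - r) \<le> M * k" "M * k \<le> real_of_int (Y - r)" by linarith+
      then have "real_of_int (X - r) / M \<le> k" "k \<le> real_of_int (Y - r) / M"
        using M by (simp_all add: field_simps)
      then have "k \<in> {\<lceil>real_of_int (X - r) / M\<rceil>..\<lfloor>real_of_int (Y - r) / M\<rfloor>}"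
        by (simp add: ceiling_le_iff le_floor_iff)
      moreover have "x = r + M * k" using k by simp
      ultimately show "x \<in> (\<lambda>k. r + M * k) ` {\<lceil>real_of_int (X - r) / M\<rceil>..\<lfloor>real_of_int (Y - r) / M\<rfloor>}"
        by blast
    qed
    then have "card S \<le> card {\<lceil>real_of_int (X - r) / M\<rceil>..\<lfloor>real_of_int (Y - r) / M\<rfloor>}"
      by (rule surj_card_le[rotated]) simp
    also have "\<dots> = nat (\<lfloor>real_of_int (Y - r) / M\<rfloor> + 1 - \<lceil>real_of_int (X - r) / M\<rceil>)" by simp
    finally have c: "real (card S) \<le> real (nat (\<lfloor>real_of_int (Y - r) / M\<rfloor> + 1 - \<lceil>real_of_int (X - r) / M\<rceil>))"
      by (rule of_nat_mono)
    have "real_of_int (Y - X) / M = real_of_int (Y - r) / M - real_of_int (X - r) / M"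
      by (simp add: diff_divide_distrib)
    moreover have "real_of_int (Y - X) / M \<ge> 0" using M XY by simp
    ultimately show ?thesis using c by linarith
  qed
qed

lemma card_cong_interval_ge:
  fixes X Y M r :: int
  assumes M: "M > 0"
  shows "real (card {x \<in> {X..Y}. [x = r] (mod M)}) \<ge> real_of_int (Y - X) / M - 1"
proof -
  let ?I = "{\<lceil>real_of_int (X - r) / M\<rceil>..\<lfloor>real_of_int (Y - r) / M\<rfloor>}"
  have sub: "(\<lambda>k. r + M * k) ` ?I \<subseteq> {x \<in> {X..Y}. [x = r] (mod M)}"
  proof
    fix x assume "x \<in> (\<lambda>k. r + M * k) ` ?I"
    then obtain k where k: "x = r + M * k" "k \<in> ?I" by blast
    then have "real_of_int (X - r) / M \<le> k" "k \<le> real_of_int (Y - r) / M"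
      by (simp_all add: ceiling_le_iff le_floor_iff)
    then have "real_of_int (X - r) \<le> M * k" "M * k \<le> real_of_int (Y - r)"
      using M by (simp_all add: field_simps)
    then have "real_of_int (X - r) \<le> real_of_int (M * k)" "real_of_int (M * k) \<le> real_of_int (Y - r)"
      by simp_all
    then have "X - r \<le> M * k" "M * k \<le> Y - r" unfolding of_int_le_iff by simp_all
    then show "x \<in> {x \<in> {X..Y}. [x = r] (mod M)}" unfolding k(1) by (auto simp: cong_iff_dvd_diff)
  qed
  have inj: "inj_on (\<lambda>k. r + M * k) ?I" using M by (auto intro: inj_onI)
  have "card ?I = card ((\<lambda>k. r + M * k) ` ?I)" using inj by (simp add: card_image)
  also have "\<dots> \<le> card {x \<in> {X..Y}. [x = r] (mod M)}"
    by (rule card_mono[OF _ sub]) (rule finite_subset[of _ "{X..Y}"], auto)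
  finally have "real (card ?I) \<le> real (card {x \<in> {X..Y}. [x = r] (mod M)})" by (rule of_nat_mono)
  moreover have "real_of_int (Y - X) / M = real_of_int (Y - r) / M - real_of_int (X - r) / M"
    by (simp add: diff_divide_distrib)
  moreover have "real (card ?I) \<ge> real_of_int (\<lfloor>real_of_int (Y - r) / M\<rfloor> + 1 - \<lceil>real_of_int (X - r) / M\<rceil>)"
    by simp
  ultimately show ?thesis by linarith
qed

text \<open>Telescoping: 1/(m+1)^2 \<le> 1/m - 1/(m+1).\<close>

lemma sum_inverse_squares_le:
  fixes z N :: nat
  assumes "z > 0"
  shows "(\<Sum>p\<in>{z<..N}. 1 / real p ^ 2) \<le> 1 / z"
proof (cases "z \<le> N")
  case True
  then have "(\<Sum>p\<in>{z<..N}. 1 / real p ^ 2) \<le> 1 / z - 1 / N"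
  proof (induction rule: dec_induct)
    case (step m)
    have "{z<..Suc m} = insert (Suc m) {z<..m}" using step by auto
    then have "(\<Sum>p\<in>{z<..Suc m}. 1 / real p ^ 2) = 1 / real (Suc m) ^ 2 + (\<Sum>p\<in>{z<..m}. 1 / real p ^ 2)" by simp
    moreover have "1 / real (Suc m) ^ 2 \<le> 1 / m - 1 / Suc m"
    proof -
      have m: "m > 0" using step assms by simp
      then have "1 / real (Suc m) ^ 2 \<le> 1 / (real m * real (Suc m))"
        unfolding power2_eq_square by (intro divide_left_mono mult_right_mono) auto
      also have "\<dots> = 1 / m - 1 / Suc m" using m by (simp add: field_simps)
      finally show ?thesis .
    qed
    ultimately show ?case using step by linarith
  qed simp
  also have "\<dots> \<le> 1 / z" by simp
  finally show ?thesis .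
qed simp

text \<open>Uniqueness of Hensel lifting: b^m - c^m = (b - c) S, where S is congruent to m b^(m-1)
  and thus a unit modulo p.\<close>

lemma cong_prime_square_of_power_cong:
  fixes b c :: int and p m :: nat
  assumes p: "prime p" and m: "\<not> p dvd m" and b: "\<not> int p dvd b" and bc: "[b = c] (mod int p)"
    and pow: "[b ^ m = c ^ m] (mod (int p)\<^sup>2)"
  shows "[b = c] (mod (int p)\<^sup>2)"
proof -
  have pi: "prime (int p)" using p by simp
  define S where "S = (\<Sum>i<m. c ^ (m - Suc i) * b ^ i)"
  have "[S = (\<Sum>i<m. b ^ (m - Suc i) * b ^ i)] (mod int p)"
    unfolding S_def using bc by (intro cong_sum cong_mult cong_pow cong_refl) (rule cong_sym)
  also have "(\<Sum>i<m. b ^ (m - Suc i) * b ^ i) = (\<Sum>i<m. b ^ (m - 1))"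
    by (intro sum.cong) (auto simp flip: power_add)
  also have "\<dots> = int m * b ^ (m - 1)" by simp
  finally have "[S = int m * b ^ (m - 1)] (mod int p)" .
  moreover have "\<not> int p dvd int m * b ^ (m - 1)"
    using pi m b by (auto simp: prime_dvd_mult_iff dest: prime_dvd_power[OF pi])
  ultimately have "\<not> int p dvd S" using cong_dvd_iff by blast
  then have cop: "Rings.coprime ((int p)\<^sup>2) S"
    using p by (simp add: prime_imp_coprime)
  have "b ^ m - c ^ m = (b - c) * S"
    unfolding S_def by (rule power_diff_sumr2)
  then have "(int p)\<^sup>2 dvd (b - c) * S" using pow by (simp add: cong_iff_dvd_diff)
  then have "(int p)\<^sup>2 dvd b - c" using cop by (simp only: coprime_dvd_mult_left_iff)
  then show ?thesis by (simp only: cong_iff_dvd_diff)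
qed

lemma prime_not_dvd_of_dvd_trinomial_disc:
  fixes a b :: int and p n :: nat
  assumes p: "prime p" "p > n" and n: "n \<ge> 2" and a: "\<not> int p dvd a" and dvd: "int p dvd trinomial_disc n a b"
  shows "\<not> int p dvd b"
proof
  assume "int p dvd b"
  moreover have "b dvd b ^ (n - 1)" using n by (intro dvd_power) auto
  ultimately have "int p dvd int n ^ n * b ^ (n - 1)" by (intro dvd_mult) (rule dvd_trans)
  then have "int p dvd int (n - 1) ^ (n - 1) * a ^ n" using dvd unfolding trinomial_disc_def by (simp add: dvd_add_right_iff)
  moreover have pi: "prime (int p)" using p by simp
  ultimately have "int p dvd int (n - 1) ^ (n - 1) \<or> int p dvd a ^ n" by (simp only: prime_dvd_mult_iff)
  then have "int p dvd int (n - 1)" using a prime_dvd_power[OF pi] by blast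
  then have "p dvd n - 1" by simp
  moreover have "n - 1 > 0" "n - 1 < p" using p n by linarith+
  ultimately show False using nat_dvd_not_less by blast
qed

text \<open>The condition fixes b^(n-1) modulo p^2, which allows at most n - 1 residues b modulo p.
  Each lifts uniquely to p^2, so each accounts for at most one class modulo W p^2.\<close>

lemma card_square_dvd_trinomial_disc_le:
  fixes a b\<^sub>0 B W :: int and p n :: nat
  assumes p: "prime p" "p > n" and n: "n \<ge> 2" and a: "\<not> int p dvd a"
    and W: "W > 0" "\<not> int p dvd W" and B: "B \<ge> 0"
  shows "real (card {b \<in> {B..2 * B}. [b = b\<^sub>0] (mod W) \<and> (int p)\<^sup>2 dvd trinomial_disc n a b})
    \<le> real (n - 1) * (B / (W * real p ^ 2) + 1)"
proof -
  let ?S = "{b \<in> {B..2 * B}. [b = b\<^sub>0] (mod W) \<and> (int p)\<^sup>2 dvd trinomial_disc n a b}"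
  have fin: "finite ?S" by (rule finite_subset[of _ "{B..2 * B}"]) auto
  have p0: "p > 0" using p by simp
  have pi: "prime (int p)" using p by simp
  have p2: "int p dvd (int p)\<^sup>2" by (simp add: power2_eq_square)
  have "n - 1 > 0" "n - 1 < p" using p n by linarith+
  then have pn: "\<not> p dvd n - 1" using nat_dvd_not_less by blast
  have pn': "\<not> int p dvd int n" using p n nat_dvd_not_less[of n p] by simp
  have pb: "\<not> int p dvd b" if "b \<in> ?S" for b
  proof -
    have "int p dvd trinomial_disc n a b" using that p2 dvd_trans by blast
    then show ?thesis using prime_not_dvd_of_dvd_trinomial_disc[OF p n a] by blast
  qed
  have pow: "[b ^ (n - 1) = c ^ (n - 1)] (mod (int p)\<^sup>2)" if "b \<in> ?S" "c \<in> ?S" for b c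
  proof -
    have "(int p)\<^sup>2 dvd trinomial_disc n a b - trinomial_disc n a c" using that by (intro dvd_diff) auto
    also have "trinomial_disc n a b - trinomial_disc n a c = int n ^ n * (b ^ (n - 1) - c ^ (n - 1))"
      by (simp add: trinomial_disc_def algebra_simps)
    finally have d: "(int p)\<^sup>2 dvd int n ^ n * (b ^ (n - 1) - c ^ (n - 1))" .
    have "Rings.coprime ((int p)\<^sup>2) (int n ^ n)"
      using pi pn' by (simp add: prime_imp_coprime)
    then have "(int p)\<^sup>2 dvd b ^ (n - 1) - c ^ (n - 1)" using d by (simp only: coprime_dvd_mult_right_iff)
    then show ?thesis by (simp only: cong_iff_dvd_diff)
  qed
  \<comment> \<open>The image of \<open>f\<close> counts roots modulo \<open>p\<close>; each fibre
    lies in one class modulo \<open>W * (int p)\<^sup>2\<close>.\<close>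
  define f where "f = (\<lambda>b::int. nat (b mod int p))"
  have fcong: "[int (f b) = b] (mod int p)" for b using p0 by (simp add: f_def cong_def)
  have img: "card (f ` ?S) \<le> n - 1"
  proof (cases "?S = {}")
    case False
    then obtain c where c: "c \<in> ?S" by blast
    have "f ` ?S \<subseteq> {x \<in> {..<p}. [x ^ (n - 1) = f c ^ (n - 1)] (mod p)}"
    proof
      fix x assume "x \<in> f ` ?S"
      then obtain b where b: "b \<in> ?S" "x = f b" by blast
      have "[int (f b) ^ (n - 1) = b ^ (n - 1)] (mod int p)" by (intro cong_pow fcong)
      also have "[b ^ (n - 1) = c ^ (n - 1)] (mod int p)" using pow[OF b(1) c] p2 cong_dvd_modulus by blast
      also have "[c ^ (n - 1) = int (f c) ^ (n - 1)] (mod int p)" by (intro cong_pow cong_sym[OF fcong])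
      finally have "[int (f b ^ (n - 1)) = int (f c ^ (n - 1))] (mod int p)" by simp
      then have "[f b ^ (n - 1) = f c ^ (n - 1)] (mod p)" by (simp only: cong_int_iff)
      moreover have "f b < p" using p0 by (simp add: f_def nat_less_iff)
      ultimately show "x \<in> {x \<in> {..<p}. [x ^ (n - 1) = f c ^ (n - 1)] (mod p)}" using b by simp
    qed
    then have "card (f ` ?S) \<le> card {x \<in> {..<p}. [x ^ (n - 1) = f c ^ (n - 1)] (mod p)}"
      by (intro card_mono) auto
    also have "\<dots> \<le> n - 1" using p n by (intro roots_mod_prime_bound) auto
    finally show ?thesis .
  next
    case True then show ?thesis by (simp only: image_empty card.empty zero_le)
  qed
  define q where "q = B / (W * real p ^ 2) + 1"
  have q: "q \<ge> 0" unfolding q_def using B W by (intro add_nonneg_nonneg divide_nonneg_nonneg mult_nonneg_nonneg) auto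
  have fib: "real (card {b \<in> ?S. f b = y}) \<le> q" for y
  proof -
    have "real (card {b \<in> ?S. f b = y}) \<le> real_of_int (2 * B - B) / real_of_int (W * (int p)\<^sup>2) + 1"
    proof (rule card_pairwise_cong_le)
      fix b c assume "b \<in> {b \<in> ?S. f b = y}" "c \<in> {b \<in> ?S. f b = y}"
      then have b: "b \<in> ?S" "f b = y" and c: "c \<in> ?S" "f c = y" by blast+
      have "[b = c] (mod int p)" using fcong[of b] fcong[of c] b c by (metis cong_sym cong_trans)
      then have c2: "[b = c] (mod (int p)\<^sup>2)"
        using cong_prime_square_of_power_cong[OF p(1) pn pb[OF b(1)] _ pow[OF b(1) c(1)]] by blast
      have cW: "[b = c] (mod W)" using b c by (auto intro: cong_trans cong_sym)
      have "Rings.coprime (int p) W" using pi W(2) by (rule prime_imp_coprime)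
      then have "Rings.coprime W ((int p)\<^sup>2)"
        by (simp add: algebraic_semidom_class.coprime_commute)
      then show "[b = c] (mod W * (int p)\<^sup>2)" by (rule coprime_cong_mult[OF cW c2])
    qed (use W p0 B in auto)
    then show ?thesis by (simp add: q_def)
  qed
  have "card ?S \<le> (\<Sum>y\<in>f ` ?S. card {b \<in> ?S. f b = y})"
  proof -
    have "?S = (\<Union>y\<in>f ` ?S. {b \<in> ?S. f b = y})" by blast
    then have "card ?S = card (\<Union>y\<in>f ` ?S. {b \<in> ?S. f b = y})" by (rule arg_cong)
    also have "\<dots> \<le> (\<Sum>y\<in>f ` ?S. card {b \<in> ?S. f b = y})" using fin by (intro card_UN_le finite_imageI)
    finally show ?thesis .
  qed
  then have "real (card ?S) \<le> (\<Sum>y\<in>f ` ?S. real (card {b \<in> ?S. f b = y}))"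
    by (simp only: of_nat_sum[symmetric] of_nat_le_iff)
  also have "\<dots> \<le> (\<Sum>y\<in>f ` ?S. q)" by (intro sum_mono fib)
  also have "\<dots> = real (card (f ` ?S)) * q" by simp
  also have "\<dots> \<le> real (n - 1) * q" using img q by (intro mult_right_mono) auto
  finally show ?thesis unfolding q_def .
qed

text \<open>If p \<le> x, both summands 1 are absorbed into the quotients; if p > x, the factors are
  at most 2 and 2 y / x. The bound splits into a part summable over all p and a part independent of
  p.\<close>

lemma pair_divisor_term_le:
  fixes x y p :: real
  assumes x: "x > 0" and xy: "x \<le> y" and p: "p > 0"
  shows "(x / p + 1) * (y / p + 1) \<le> 4 * (x * y) * (1 / p ^ 2) + 4 * (y / x)"
proof (cases "p \<le> x")
  case True
  have "(x / p + 1) * (y / p + 1) \<le> (2 * (x / p)) * (2 * (y / p))"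
  proof (rule mult_mono)
    have "1 \<le> x / p" "1 \<le> y / p" using True xy p by simp_all
    then show "x / p + 1 \<le> 2 * (x / p)" "y / p + 1 \<le> 2 * (y / p)" "0 \<le> 2 * (x / p)" "0 \<le> y / p + 1" by linarith+
  qed
  also have "\<dots> = 4 * (x * y) * (1 / p ^ 2)" by (simp add: power2_eq_square)
  also have "\<dots> \<le> 4 * (x * y) * (1 / p ^ 2) + 4 * (y / x)" using x xy by simp
  finally show ?thesis .
next
  case False
  have "y / p \<le> y / x" using False x xy by (intro divide_left_mono) auto
  moreover have "1 \<le> y / x" using x xy by simp
  ultimately have 1: "y / p + 1 \<le> 2 * (y / x)" by linarith
  have 2: "x / p + 1 \<le> 2" using False p by simp
  have "0 \<le> y / p" using x xy p by simp
  then have "(x / p + 1) * (y / p + 1) \<le> 2 * (2 * (y / x))"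
    by (intro mult_mono 1 2) linarith+
  also have "\<dots> \<le> 4 * (x * y) * (1 / p ^ 2) + 4 * (y / x)" using x xy by simp
  finally show ?thesis .
qed

section \<open>Dyadic intervals in residue classes, and the sieve over pairs (a, b)\<close>

definition residue_box :: "int \<Rightarrow> int \<Rightarrow> int \<Rightarrow> int set" where
  "residue_box W r X = {x \<in> {X..2 * X}. [x = r] (mod W)}"

lemma finite_residue_box [simp]: "finite (residue_box W r X)"
  unfolding residue_box_def by (rule finite_subset[of _ "{X..2 * X}"]) auto

lemma card_residue_box_le:
  assumes "W > 0" "X \<ge> 0"
  shows "real (card (residue_box W r X)) \<le> X / W + 1"
proof -
  have "real (card (residue_box W r X)) \<le> real_of_int (2 * X - X) / W + 1"
    by (rule card_pairwise_cong_le) (use assms in \<open>auto simp: residue_box_def intro: cong_trans cong_sym\<close>)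
  then show ?thesis by simp
qed

lemma card_residue_box_ge:
  assumes "W > 0"
  shows "real (card (residue_box W r X)) \<ge> X / W - 1"
  using card_cong_interval_ge[OF assms, where X = X and Y = "2 * X" and r = r] by (simp add: residue_box_def)

lemma card_residue_box_dvd_le:
  assumes W: "W > 0" "\<not> int p dvd W" and X: "X \<ge> 0" and p: "prime p"
  shows "real (card {x \<in> residue_box W r X. int p dvd x}) \<le> X / W / p + 1"
proof -
  have pi: "prime (int p)" using p by simp
  have "Rings.coprime (int p) W" using pi W(2) by (rule prime_imp_coprime)
  then have cop: "Rings.coprime W (int p)" by (simp add: algebraic_semidom_class.coprime_commute)
  have "real (card {x \<in> residue_box W r X. int p dvd x}) \<le> real_of_int (2 * X - X) / real_of_int (W * int p) + 1"
  proof (rule card_pairwise_cong_le)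
    fix x y assume "x \<in> {x \<in> residue_box W r X. int p dvd x}" "y \<in> {x \<in> residue_box W r X. int p dvd x}"
    then have "[x = y] (mod W)" "int p dvd x" "int p dvd y"
      by (auto simp: residue_box_def intro: cong_trans cong_sym)
    moreover from this have "[x = y] (mod int p)" by (simp add: cong_iff_dvd_diff)
    ultimately show "[x = y] (mod W * int p)" using cop by (intro coprime_cong_mult)
  qed (use W X p in \<open>auto simp: residue_box_def prime_gt_0_nat\<close>)
  then show ?thesis by simp
qed

text \<open>
  Primes dividing \<open>a\<close> are counted separately (the sets \<open>R\<close>): for such \<open>p\<close> every multiple \<open>b\<close> of \<open>p\<close>
  is bad, which is too much for a single \<open>a\<close> but harmless on average over \<open>a\<close>.
\<close>

lemma card_no_medium_square_factors_ge:
  fixes A B W a\<^sub>0 b\<^sub>0 :: int and n z :: nat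
  assumes n: "n \<ge> 2" and W: "W > 0" and z: "z \<ge> 64 * n" and zW: "\<And>p. prime p \<Longrightarrow> p > z \<Longrightarrow> \<not> int p dvd W"
    and A: "A \<ge> 256 * W\<^sup>2" and AB: "A \<le> B"
  shows "real (card {(a, b) \<in> residue_box W a\<^sub>0 A \<times> residue_box W b\<^sub>0 B.
      \<forall>p::nat. prime p \<longrightarrow> z < p \<longrightarrow> real p \<le> B / (64 * n * W) \<longrightarrow>
        \<not> (int p)\<^sup>2 dvd trinomial_disc n a b \<and> \<not> (int p)\<^sup>2 dvd trinomial_disc n (- a) b})
    \<ge> A * B / (32 * W\<^sup>2)" (is "real (card ?G) \<ge> _")
proof -
  define PA where "PA = residue_box W a\<^sub>0 A"
  define PB where "PB = residue_box W b\<^sub>0 B"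
  define x where "x = real_of_int A / W"
  define y where "y = real_of_int B / W"
  define N where "N = nat \<lfloor>B / (64 * n * W)\<rfloor>"
  define Pr where "Pr = {p. prime p \<and> p \<in> {z<..N}}"
  \<comment> \<open>The sign \<open>s\<close> covers both discriminants belonging to a positive
    \<open>a\<close>.\<close>
  define Q where "Q = (\<lambda>p::nat. \<lambda>s::int. {(a, b) \<in> PA \<times> PB. \<not> int p dvd a \<and> (int p)\<^sup>2 dvd trinomial_disc n (s * a) b})"
  define R where "R = (\<lambda>p::nat. {a \<in> PA. int p dvd a} \<times> {b \<in> PB. int p dvd b})"
  have W1: "real_of_int W \<ge> 1" using W by simp
  have "W\<^sup>2 > 0" using W by simp
  then have A0: "A > 0" using A by linarith
  have x_ge: "x \<ge> 256 * W"
  proof -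
    have "real_of_int (256 * W\<^sup>2) \<le> real_of_int A" using A by (simp only: of_int_le_iff)
    then show ?thesis unfolding x_def using W by (simp add: field_simps power2_eq_square)
  qed
  have x: "x \<ge> 256" using x_ge W1 by linarith
  have xy: "x \<le> y" unfolding x_def y_def using AB W by (simp add: divide_right_mono)
  have finPr: "finite Pr" unfolding Pr_def by (rule finite_subset[of _ "{z<..N}"]) auto
  have fin: "finite (PA \<times> PB)" unfolding PA_def PB_def by simp
  have Npos: "B / (64 * n * W) \<ge> 0" using AB A0 W by simp
  have PrD: "prime p" "p > z" "p > n" "\<not> int p dvd W" "\<not> int p dvd int n" "real p \<ge> 1" if "p \<in> Pr" for p
  proof -
    show p: "prime p" "p > z" using that by (auto simp: Pr_def)
    then show "p > n" using z by linarith
    then show "\<not> int p dvd int n" using n nat_dvd_not_less[of n p] by simp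
    show "\<not> int p dvd W" using zW p by blast
    show "real p \<ge> 1" using p by linarith
  qed
  have sumPr: "(\<Sum>p\<in>Pr. 1 / real p ^ 2) \<le> 1 / (64 * n)"
  proof -
    have "(\<Sum>p\<in>Pr. 1 / real p ^ 2) \<le> (\<Sum>p\<in>{z<..N}. 1 / real p ^ 2)"
      by (rule sum_mono2) (auto simp: Pr_def)
    also have "\<dots> \<le> 1 / z" using z n by (intro sum_inverse_squares_le) auto
    also have "\<dots> \<le> 1 / (64 * n)" using z n by (intro divide_left_mono) auto
    finally show ?thesis .
  qed
  \<comment> \<open>All integers up to \<open>N\<close> are counted. The factor 64 n W in the cutoff
    makes even this crude bound small against \<open>y\<close>.\<close>
  have cardPr: "real (card Pr) \<le> y / (64 * n)"
  proof -
    have "card Pr \<le> card {z<..N}" by (rule card_mono) (auto simp: Pr_def)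
    then have "real (card Pr) \<le> real N" by simp
    also have "\<dots> \<le> B / (64 * n * W)" using Npos unfolding N_def by (simp add: of_nat_floor)
    also have "\<dots> = y / (64 * n)" by (simp add: y_def mult_ac)
    finally show ?thesis .
  qed
  have "real (card PA) \<le> x + 1" "x - 1 \<le> real (card PA)" "y - 1 \<le> real (card PB)"
    using card_residue_box_le[OF W, of A a\<^sub>0] card_residue_box_ge[OF W, of A a\<^sub>0]
      card_residue_box_ge[OF W, of B b\<^sub>0] A0
    unfolding PA_def PB_def x_def y_def by simp_all
  then have cardPA: "real (card PA) \<le> 2 * x" "real (card PA) \<ge> x / 2"
    and cardPB: "real (card PB) \<ge> y / 2" using x xy by linarith+
  have cardQ: "real (card (Q p s)) \<le> 2 * x * (n * (y * (1 / real p ^ 2) + 1))"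
    if p: "p \<in> Pr" and s: "s = 1 \<or> s = -1" for p s
  proof -
    let ?F = "\<lambda>a. {b \<in> {B..2 * B}. [b = b\<^sub>0] (mod W) \<and> (int p)\<^sup>2 dvd trinomial_disc n (s * a) b}"
    let ?PA = "{a \<in> PA. \<not> int p dvd a}"
    have "Q p s = (SIGMA a:?PA. ?F a)"
      unfolding Q_def PB_def residue_box_def by auto
    moreover have "finite (?F a)" for a by (rule finite_subset[of _ "{B..2 * B}"]) auto
    moreover have finPA: "finite ?PA" unfolding PA_def by simp
    ultimately have "real (card (Q p s)) = (\<Sum>a\<in>?PA. real (card (?F a)))"
      by (simp add: card_SigmaI)
    also have "\<dots> \<le> (\<Sum>a\<in>?PA. real (n - 1) * (B / (W * real p ^ 2) + 1))"
    proof (rule sum_mono)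
      fix a assume "a \<in> ?PA"
      then have "\<not> int p dvd s * a" using s by auto
      then show "real (card (?F a)) \<le> real (n - 1) * (B / (W * real p ^ 2) + 1)"
        using PrD[OF p] n W AB A0 by (intro card_square_dvd_trinomial_disc_le) auto
    qed
    also have "\<dots> = real (card ?PA) * (real (n - 1) * (y * (1 / real p ^ 2) + 1))"
      by (simp add: y_def)
    also have "\<dots> \<le> (2 * x) * (n * (y * (1 / real p ^ 2) + 1))"
    proof (rule mult_mono)
      have "card ?PA \<le> card PA" unfolding PA_def by (intro card_mono) auto
      then show "real (card ?PA) \<le> 2 * x" using cardPA by linarith
      show "real (n - 1) * (y * (1 / real p ^ 2) + 1) \<le> n * (y * (1 / real p ^ 2) + 1)"
        using x xy by (intro mult_right_mono) auto
    qed (use x xy in auto)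
    finally show ?thesis .
  qed
  have sumQ: "(\<Sum>p\<in>Pr. real (card (Q p s))) \<le> x * y / 16" if s: "s = 1 \<or> s = -1" for s
  proof -
    have "(\<Sum>p\<in>Pr. real (card (Q p s))) \<le> (\<Sum>p\<in>Pr. 2 * x * (n * (y * (1 / real p ^ 2) + 1)))"
      by (intro sum_mono cardQ s)
    also have "\<dots> = 2 * x * (n * (y * (\<Sum>p\<in>Pr. 1 / real p ^ 2) + card Pr))"
      by (simp only: sum_distrib_left[symmetric] sum.distrib sum_constant mult_1_right)
    also have "\<dots> \<le> 2 * x * (n * (y * (1 / (64 * n)) + y / (64 * n)))"
      using x xy sumPr cardPr by (intro mult_left_mono add_mono) auto
    also have "\<dots> = x * y / 16" using n by (simp add: field_simps)
    finally show ?thesis .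
  qed
  \<comment> \<open>A prime above 2 A divides no \<open>a\<close> in the box, so only 2 A terms y /
    x have to be paid for, although \<open>Pr\<close> may reach far beyond 2 A.\<close>
  have cardR: "real (card (R p)) \<le> (if p \<in> {..nat (2 * A)} then 4 * (x * y) * (1 / real p ^ 2) + 4 * (y / x) else 0)"
    if p: "p \<in> Pr" for p
  proof (cases "p \<in> {..nat (2 * A)}")
    case True
    have "real (card (R p)) = real (card {a \<in> PA. int p dvd a}) * real (card {b \<in> PB. int p dvd b})"
      unfolding R_def by (simp add: card_cartesian_product)
    also have "\<dots> \<le> (x / p + 1) * (y / p + 1)"
      unfolding x_def y_def PA_def PB_def using PrD[OF p] W A0 AB
      by (intro mult_mono card_residue_box_dvd_le) auto
    also have "\<dots> \<le> 4 * (x * y) * (1 / real p ^ 2) + 4 * (y / x)"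
      using x xy PrD[OF p] by (intro pair_divisor_term_le) auto
    finally show ?thesis using True by simp
  next
    case False
    have "{a \<in> PA. int p dvd a} = {}"
    proof -
      have "\<not> int p dvd a" if "a \<in> PA" for a
      proof
        assume "int p dvd a"
        moreover have "0 < a" "a \<le> 2 * A" using that A0 by (auto simp: PA_def residue_box_def)
        ultimately have "int p \<le> 2 * A" using zdvd_imp_le by fastforce
        then show False using False by auto
      qed
      then show ?thesis by blast
    qed
    then have "R p = {}" unfolding R_def by (simp only: Times_empty simp_thms)
    then show ?thesis using False by simp
  qed
  \<comment> \<open>The first part contributes x y / 16. The second is 8 W y, which is at most x y /
    32 because x \<ge> 256 W.\<close>
  have sumR: "(\<Sum>p\<in>Pr. real (card (R p))) \<le> x * y * (3 / 32)"
  proof -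
    let ?T = "Pr \<inter> {..nat (2 * A)}"
    have "0 \<notin> Pr" by (auto simp: Pr_def)
    then have "?T \<subseteq> {1..nat (2 * A)}" by (auto simp: Suc_le_eq intro: Nat.gr0I)
    then have "card ?T \<le> card {1..nat (2 * A)}" by (intro card_mono) auto
    then have cT: "real (card ?T) \<le> 2 * A" using A0 by simp
    have "(\<Sum>p\<in>Pr. real (card (R p))) \<le> (\<Sum>p\<in>Pr. if p \<in> {..nat (2 * A)} then 4 * (x * y) * (1 / real p ^ 2) + 4 * (y / x) else 0)"
      by (intro sum_mono cardR)
    also have "\<dots> = (\<Sum>p\<in>?T. 4 * (x * y) * (1 / real p ^ 2) + 4 * (y / x))"
      using finPr by (subst sum.inter_restrict) auto
    also have "\<dots> = 4 * (x * y) * (\<Sum>p\<in>?T. 1 / real p ^ 2) + card ?T * (4 * (y / x))"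
      by (simp only: sum_distrib_left[symmetric] sum.distrib sum_constant mult.left_commute)
    also have "\<dots> \<le> 4 * (x * y) * (1 / 64) + (2 * A) * (4 * (y / x))"
    proof (intro add_mono mult_left_mono mult_right_mono cT)
      have "(\<Sum>p\<in>?T. 1 / real p ^ 2) \<le> (\<Sum>p\<in>Pr. 1 / real p ^ 2)" using finPr by (intro sum_mono2) auto
      also have "\<dots> \<le> 1 / (64 * n)" by (rule sumPr)
      also have "\<dots> \<le> 1 / 64" using n by (simp add: field_simps)
      finally show "(\<Sum>p\<in>?T. 1 / real p ^ 2) \<le> 1 / 64" .
    qed (use x xy in auto)
    also have "(2 * A) * (4 * (y / x)) = 8 * W * y" using A0 W by (simp add: x_def)
    also have "8 * W * y \<le> x * y / 32"
    proof -
      have "8 * W * y \<le> (x / 32) * y" using x_ge x xy by (intro mult_right_mono) auto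
      then show ?thesis by simp
    qed
    finally show ?thesis by simp
  qed
  define Bad where "Bad = (\<Union>p\<in>Pr. Q p 1 \<union> Q p (-1) \<union> R p)"
  have finQR: "finite (Q p s)" "finite (R p)" for p s
    unfolding Q_def R_def by (rule finite_subset[OF _ fin], auto)+
  have "real (card Bad) \<le> (\<Sum>p\<in>Pr. real (card (Q p 1)) + real (card (Q p (-1))) + real (card (R p)))"
  proof -
    have "card Bad \<le> (\<Sum>p\<in>Pr. card (Q p 1 \<union> Q p (-1) \<union> R p))"
      unfolding Bad_def using finPr by (rule card_UN_le)
    also have "\<dots> \<le> (\<Sum>p\<in>Pr. card (Q p 1) + card (Q p (-1)) + card (R p))"
      by (intro sum_mono order_trans[OF card_Un_le] add_mono card_Un_le order_refl)
    finally have "real (card Bad) \<le> real (\<Sum>p\<in>Pr. card (Q p 1) + card (Q p (-1)) + card (R p))"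
      by (rule of_nat_mono)
    then show ?thesis by simp
  qed
  also have "\<dots> \<le> x * y / 16 + x * y / 16 + x * y * (3 / 32)"
    unfolding sum.distrib by (intro add_mono sumQ sumR) auto
  \<comment> \<open>At least x y / 4 pairs are available, so at least x y / 32 survive.\<close>
  finally have cardBad: "real (card Bad) \<le> x * y * (7 / 32)" by simp
  have "real (card (PA \<times> PB)) \<ge> (x / 2) * (y / 2)"
    unfolding card_cartesian_product of_nat_mult using x xy cardPA cardPB by (intro mult_mono) auto
  moreover have "PA \<times> PB - Bad \<subseteq> ?G"
  proof
    fix ab assume ab: "ab \<in> PA \<times> PB - Bad"
    obtain a b where e: "ab = (a, b)" by (cases ab)
    have mem: "a \<in> PA" "b \<in> PB" "(a, b) \<notin> Bad" using ab e by auto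
    \<comment> \<open>If p does not divide a, a bad pair lies in \<open>Q p s\<close>. If it does,
      then p divides n^n b^(n-1), hence b, and the pair lies in \<open>R p\<close>.\<close>
    have "\<not> (int p)\<^sup>2 dvd trinomial_disc n (s * a) b"
      if p: "prime p" "z < p" "real p \<le> B / (64 * n * W)" and s: "s = 1 \<or> s = -1" for p s
    proof
      assume d: "(int p)\<^sup>2 dvd trinomial_disc n (s * a) b"
      have "p \<le> N" unfolding N_def using p(3) by (simp add: le_nat_floor)
      then have pP: "p \<in> Pr" using p by (simp add: Pr_def)
      then have nb: "(a, b) \<notin> Q p 1" "(a, b) \<notin> Q p (-1)" "(a, b) \<notin> R p" using mem unfolding Bad_def by blast+
      have "(a, b) \<notin> Q p s" using nb s by auto
      then have pa: "int p dvd a" using mem d unfolding Q_def by blast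
      have pi: "prime (int p)" using p by simp
      have "int p dvd (int p)\<^sup>2" by (simp add: power2_eq_square)
      then have "int p dvd trinomial_disc n (s * a) b" using d by (rule dvd_trans)
      moreover have "s * a dvd (s * a) ^ n" using n by (intro dvd_power) auto
      then have "int p dvd (s * a) ^ n" using pa by (meson dvd_mult dvd_trans)
      ultimately have "int p dvd int n ^ n * b ^ (n - 1)"
        unfolding trinomial_disc_def by (simp add: dvd_add_left_iff)
      then have "int p dvd int n ^ n \<or> int p dvd b ^ (n - 1)" using pi by (simp only: prime_dvd_mult_iff)
      then have "int p dvd b" using PrD(5)[OF pP] prime_dvd_power[OF pi] by blast
      then show False using nb(3) pa mem unfolding R_def by blast
    qed
    from this[of _ 1] this[of _ "-1"] show "ab \<in> ?G" using mem unfolding e PA_def PB_def by simp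
  qed
  then have "card (PA \<times> PB - Bad) \<le> card ?G"
    by (rule card_mono[rotated]) (rule finite_subset[OF _ fin], auto simp: PA_def PB_def)
  moreover have "card (PA \<times> PB) - card Bad \<le> card (PA \<times> PB - Bad)"
    by (rule diff_card_le_card_Diff) (simp add: Bad_def finPr finQR)
  ultimately have "real (card ?G) \<ge> (x / 2) * (y / 2) - x * y * (7 / 32)"
    using cardBad by linarith
  also have "(x / 2) * (y / 2) - x * y * (7 / 32) = A * B / (32 * W\<^sup>2)"
    unfolding x_def y_def by (simp add: power2_eq_square)
  finally show ?thesis .
qed

section \<open>Residue classes without small prime factors\<close>

text \<open>The Chinese remainder theorem with W equal to n times the product of \<open>P\<close>.
  The conditions serve twice: they keep small primes out of both discriminants, and they supply the
  primitive roots needed for irreducibility.\<close>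

lemma residue_classes_for_small_primes:
  fixes n z :: nat
  assumes n: "n > 0"
  defines "P \<equiv> {p. prime p \<and> p \<le> z \<and> \<not> p dvd n}"
  shows "\<exists>(W::int) a\<^sub>0 b\<^sub>0. W > 0 \<and> (\<forall>p. prime p \<longrightarrow> p > z \<longrightarrow> p > n \<longrightarrow> \<not> int p dvd W) \<and>
    (\<forall>a. [a = a\<^sub>0] (mod W) \<longrightarrow> [a = 1] (mod int n) \<and> (\<forall>p\<in>P. int p dvd a)) \<and>
    (\<forall>b. [b = b\<^sub>0] (mod W) \<longrightarrow> (\<forall>p\<in>P. \<exists>\<beta>. residue_primroot p \<beta> \<and> [b = int \<beta>] (mod int p)))"
proof -
  have fin: "finite P" unfolding P_def by (rule finite_subset[of _ "{..z}"]) auto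
  define Q where "Q = (\<Prod>p\<in>P. int p)"
  define W where "W = int n * Q"
  have prP: "prime p" if "p \<in> P" for p using that by (simp add: P_def)
  have Q: "Q > 0" unfolding Q_def by (intro prod_pos) (auto dest: prP simp: prime_gt_0_nat)
  have dvdQ: "int p dvd Q" if "p \<in> P" for p unfolding Q_def using fin that by (rule dvd_prodI)
  have "Rings.coprime Q (int n)"
    unfolding Q_def
  proof (rule prod_coprime_left)
    fix p assume "p \<in> P"
    then have "prime (int p)" "\<not> int p dvd int n" by (auto simp: P_def)
    then show "Rings.coprime (int p) (int n)" by (rule prime_imp_coprime)
  qed
  then obtain a\<^sub>0 where a0: "[a\<^sub>0 = 0] (mod Q)" "[a\<^sub>0 = 1] (mod int n)"
    using binary_chinese_remainder_int by blast
  define g where "g = (\<lambda>p::nat. SOME x. residue_primroot p x)"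
  have g: "residue_primroot p (g p)" if "p \<in> P" for p
    unfolding g_def by (rule someI_ex) (rule prime_primitive_root_exists[OF prime_gt_1_nat[OF prP[OF that]] prP[OF that]])
  have "\<forall>i\<in>P. \<forall>j\<in>P. i \<noteq> j \<longrightarrow> Rings.coprime i j"
    using prP by (auto intro: primes_coprime)
  then obtain \<beta> where \<beta>: "\<forall>p\<in>P. [\<beta> = g p] (mod p)"
    using chinese_remainder_nat[OF fin, of "\<lambda>p. p" g] by blast
  show ?thesis
  proof (intro exI conjI allI impI ballI)
    show "W > 0" using Q n by (simp add: W_def)
    show "\<not> int p dvd W" if p: "prime p" "p > z" "p > n" for p
    proof
      assume d: "int p dvd W"
      have pi: "prime (int p)" using p by simp
      have "\<not> int p dvd int n" using p n nat_dvd_not_less by auto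
      then have "int p dvd Q" using d pi unfolding W_def by (simp add: prime_dvd_mult_iff)
      then obtain q where q: "q \<in> P" "int p dvd int q" unfolding Q_def using prime_dvd_prod_iff[OF fin pi] by blast
      then have "p = q" using p(1) prP by (simp add: primes_dvd_imp_eq)
      then show False using q p by (simp add: P_def)
    qed
    show "[a = 1] (mod int n)" if "[a = a\<^sub>0] (mod W)" for a
    proof -
      have "[a = a\<^sub>0] (mod int n)" using that unfolding W_def by (rule cong_modulus_mult)
      then show ?thesis using a0(2) by (rule cong_trans)
    qed
    show "int p dvd a" if "[a = a\<^sub>0] (mod W)" "p \<in> P" for a p
    proof -
      have "[a = a\<^sub>0] (mod Q)" using that(1) unfolding W_def mult.commute[of "int n"] by (rule cong_modulus_mult)
      then have "[a = 0] (mod Q)" using a0(1) by (rule cong_trans)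
      then show ?thesis using dvdQ[OF that(2)] by (auto simp: cong_0_iff intro: dvd_trans)
    qed
    show "residue_primroot p (g p)" if "p \<in> P" for p using g[OF that] .
    show "[b = int (g p)] (mod int p)" if "[b = int \<beta>] (mod W)" "p \<in> P" for b p
    proof -
      have "int p dvd W" unfolding W_def using dvdQ[OF that(2)] by simp
      then have "[b = int \<beta>] (mod int p)" using that(1) cong_dvd_modulus by blast
      moreover have "[int \<beta> = int (g p)] (mod int p)" using \<beta> that(2) by (simp add: cong_int_iff)
      ultimately show ?thesis by (rule cong_trans)
    qed
  qed
qed

text \<open>One cutoff below which every prime power exactly dividing n has its witness q, so that
  the residue classes for small primes control all witnesses.\<close>

lemma prime_power_moduli_bounded:
  fixes n :: nat
  assumes n: "n > 0"
  shows "\<exists>z. \<forall>p. prime p \<longrightarrow> p dvd n \<longrightarrow> (\<exists>q\<le>z. prime q \<and> \<not> q dvd n \<and> p ^ multiplicity p n dvd q - 1)"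
proof -
  have "\<exists>q. prime q \<and> \<not> q dvd n \<and> p ^ multiplicity p n dvd q - 1" if "p \<in> prime_factors n" for p
  proof -
    have "prime p" "p dvd n" using that by (auto simp: in_prime_factors_iff)
    moreover have "multiplicity p n > 0" using that by (simp add: prime_factors_multiplicity)
    ultimately show ?thesis using n by (intro prime_power_dvd_prime_minus_1)
  qed
  then obtain h where h: "\<And>p. p \<in> prime_factors n \<Longrightarrow> prime (h p) \<and> \<not> h p dvd n \<and> p ^ multiplicity p n dvd h p - 1"
    by metis
  show ?thesis
  proof (rule exI[of _ "\<Sum>p\<in>prime_factors n. h p"], intro allI impI)
    fix p assume "prime p" "p dvd n"
    then have p: "p \<in> prime_factors n" using n by (simp add: in_prime_factors_iff)
    then have "h p \<le> (\<Sum>p\<in>prime_factors n. h p)" by (intro member_le_sum) auto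
    then show "\<exists>q\<le>(\<Sum>p\<in>prime_factors n. h p). prime q \<and> \<not> q dvd n \<and> p ^ multiplicity p n dvd q - 1"
      using h[OF p] by blast
  qed
qed

text \<open>Modulo p exactly one of the two terms of the discriminant vanishes: the first if p
  divides n, the second if p divides a. The other is a product of units.\<close>

lemma trinomial_disc_not_dvd_small:
  fixes a b :: int and p n :: nat
  assumes p: "prime p" and n: "n \<ge> 2" and a1: "[a = 1] (mod int n)"
    and pa: "\<not> p dvd n \<Longrightarrow> int p dvd a" and pb: "\<not> p dvd n \<Longrightarrow> \<not> int p dvd b" and s: "s = 1 \<or> s = -1"
  shows "\<not> int p dvd trinomial_disc n (s * a) b"
proof
  assume d: "int p dvd trinomial_disc n (s * a) b"
  have pi: "prime (int p)" using p by simp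
  show False
  proof (cases "p dvd n")
    case True
    then have "int p dvd int n" by simp
    moreover have "int n dvd int n ^ n" using n by (intro dvd_power) auto
    ultimately have "int p dvd int n ^ n * b ^ (n - 1)" by (intro dvd_mult2) (rule dvd_trans)
    then have "int p dvd int (n - 1) ^ (n - 1) * (s * a) ^ n"
      using d unfolding trinomial_disc_def by (simp add: dvd_add_right_iff)
    then have "int p dvd int (n - 1) ^ (n - 1) \<or> int p dvd (s * a) ^ n"
      by (simp only: prime_dvd_mult_iff[OF pi])
    then have "int p dvd int (n - 1) \<or> int p dvd s * a"
      using prime_dvd_power[OF pi] by blast
    moreover have "\<not> int p dvd int (n - 1)"
    proof
      assume "int p dvd int (n - 1)"
      then have "p dvd n - 1" by simp
      then have "p dvd n - (n - 1)" using True by (rule dvd_diff_nat[rotated])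
      then show False using p n by simp
    qed
    moreover have "\<not> int p dvd a"
    proof
      assume "int p dvd a"
      moreover have "[a = 1] (mod int p)" using a1 True by (auto intro: cong_dvd_modulus)
      ultimately have "int p dvd 1" using cong_dvd_iff by blast
      then show False using pi by auto
    qed
    ultimately show False using s by auto
  next
    case False
    have "s * a dvd (s * a) ^ n" using n by (intro dvd_power) auto
    then have "int p dvd (s * a) ^ n" using pa[OF False] by (meson dvd_mult dvd_trans)
    then have "int p dvd int n ^ n * b ^ (n - 1)"
      using d unfolding trinomial_disc_def by (simp add: dvd_add_left_iff)
    then have "int p dvd int n ^ n \<or> int p dvd b ^ (n - 1)"
      by (simp only: prime_dvd_mult_iff[OF pi])
    then have "int p dvd int n \<or> int p dvd b" using prime_dvd_power[OF pi] by blast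
    then show False using pb False by simp
  qed
qed

section \<open>Choice of the sign of a, and the lower bound\<close>

theorem theorem1:
  fixes n :: nat and \<delta>\<^sub>0 :: real
  assumes abc: abc_conjecture
    and n_ge: "n \<ge> 5" and n_odd: "odd n" and n_mod: "n mod 4 = 1"
    and \<delta>_pos: "\<delta>\<^sub>0 > 0"
  shows "\<exists>c::real. c > 0 \<and> (\<exists>A\<^sub>0::int. \<forall>A B :: int.
           A \<ge> A\<^sub>0 \<longrightarrow> A > 1 \<longrightarrow> B > 1 \<longrightarrow> real_of_int B > real_of_int A powr (1 + \<delta>\<^sub>0) \<longrightarrow>
           real (card (M_set n A B)) \<ge> c * real_of_int A * real_of_int B)"
proof -
  have n0: "n > 0" and n2: "n \<ge> 2" using n_ge by auto
  obtain z\<^sub>1 where z1: "\<And>p. prime p \<Longrightarrow> p dvd n \<Longrightarrow>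
      \<exists>q\<le>z\<^sub>1. prime q \<and> \<not> q dvd n \<and> p ^ multiplicity p n dvd q - 1"
    using prime_power_moduli_bounded[OF n0] by blast
  \<comment> \<open>The sieve needs 64 n; irreducibility needs the witnesses up to
    \<open>z\<^sub>1\<close>.\<close>
  define z where "z = max (64 * n) z\<^sub>1"
  define P where "P = {p. prime p \<and> p \<le> z \<and> \<not> p dvd n}"
  obtain W a\<^sub>0 b\<^sub>0 :: int where W: "W > 0"
    and WP: "\<forall>p. prime p \<longrightarrow> p > z \<longrightarrow> p > n \<longrightarrow> \<not> int p dvd W"
    and aW: "\<forall>a. [a = a\<^sub>0] (mod W) \<longrightarrow> [a = 1] (mod int n) \<and> (\<forall>p\<in>P. int p dvd a)"
    and bW: "\<forall>b. [b = b\<^sub>0] (mod W) \<longrightarrow> (\<forall>p\<in>P. \<exists>\<beta>. residue_primroot p \<beta> \<and> [b = int \<beta>] (mod int p))"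
    using residue_classes_for_small_primes[OF n0, of z] unfolding P_def[symmetric] by (elim exE conjE)
  have a1: "[a = 1] (mod int n)" if "[a = a\<^sub>0] (mod W)" for a
    using aW that by blast
  have aP: "int p dvd a" if "[a = a\<^sub>0] (mod W)" "prime p" "p \<le> z" "\<not> p dvd n" for a p
    using aW that by (simp add: P_def)
  have bP: "\<exists>\<beta>. residue_primroot p \<beta> \<and> [b = int \<beta>] (mod int p)"
    if "[b = b\<^sub>0] (mod W)" "prime p" "p \<le> z" "\<not> p dvd n" for b p
    using bW that by (simp add: P_def)
  \<comment> \<open>With this value the large primes begin exactly where the sieve range B / (64 n
    W) ends.\<close>
  define K where "K = 64 * real n * W"
  have K1: "K \<ge> 1"
  proof -
    have "1 * 1 \<le> 64 * real n * W" using n0 W by (intro mult_mono) auto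
    then show ?thesis by (simp add: K_def)
  qed
  obtain B\<^sub>1 where B1: "\<forall>(a::int) (b::int) (A::real) (B::real) (p\<^sub>1::nat) (p\<^sub>2::nat).
      1 \<le> A \<longrightarrow> A powr (1 + \<delta>\<^sub>0) < B \<longrightarrow> B\<^sub>1 \<le> B \<longrightarrow> 0 < a \<longrightarrow> a \<le> 2 * A \<longrightarrow> 0 < b \<longrightarrow> b \<le> 2 * B \<longrightarrow>
      Rings.coprime (int n * b) (int (n - 1) * a) \<longrightarrow> prime p\<^sub>1 \<longrightarrow> prime p\<^sub>2 \<longrightarrow>
      B / K < p\<^sub>1 \<longrightarrow> B / K < p\<^sub>2 \<longrightarrow> (int p\<^sub>1)\<^sup>2 dvd trinomial_disc n a b \<longrightarrow>
      \<not> (int p\<^sub>2)\<^sup>2 dvd trinomial_disc n (- a) b"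
    using no_two_large_square_factors[OF abc n_odd n2 \<delta>_pos, of K] K1 by auto
  \<comment> \<open>The first entry is for the sieve and the second for the abc bound. The third
    gives 2 A K < B, so that every prime dividing a is at most B / K.\<close>
  define A\<^sub>0 where "A\<^sub>0 = max (256 * W\<^sup>2) (max \<lceil>B\<^sub>1\<rceil> \<lceil>(2 * K) powr (1 / \<delta>\<^sub>0)\<rceil>)"
  define c :: real where "c = 1 / (32 * W\<^sup>2)"
  have "c > 0" using W by (simp add: c_def)
  moreover have "real (card (M_set n A B)) \<ge> c * real_of_int A * real_of_int B"
    if A: "A \<ge> A\<^sub>0" "A > 1" and B: "real_of_int B > real_of_int A powr (1 + \<delta>\<^sub>0)" for A B :: int
  proof -
    have "A \<ge> \<lceil>(2 * K) powr (1 / \<delta>\<^sub>0)\<rceil>" and AB1: "real_of_int A \<ge> B\<^sub>1" and AW: "A \<ge> 256 * W\<^sup>2"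
      using A unfolding A\<^sub>0_def by (simp_all add: ceiling_le_iff)
    then have Apow: "real_of_int A \<ge> (2 * K) powr (1 / \<delta>\<^sub>0)" by (simp add: ceiling_le_iff)
    have "2 * K = ((2 * K) powr (1 / \<delta>\<^sub>0)) powr \<delta>\<^sub>0" using K1 \<delta>_pos by (simp add: powr_powr)
    also have "\<dots> \<le> A powr \<delta>\<^sub>0" using Apow \<delta>_pos by (intro powr_mono2) auto
    finally have "A * (2 * K) \<le> A * A powr \<delta>\<^sub>0" using A by (intro mult_left_mono) auto
    also have "\<dots> = A powr (1 + \<delta>\<^sub>0)" using A by (simp add: powr_add)
    finally have AKB: "A * (2 * K) < B" using B by linarith
    have "real_of_int A * 1 \<le> real_of_int A * (2 * K)" using A K1 by (intro mult_left_mono) auto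
    then have AB: "A \<le> B" using AKB by linarith
    have AK: "2 * A \<le> B / K" using AKB K1 by (simp add: field_simps)
    define G where "G = {(a, b) \<in> residue_box W a\<^sub>0 A \<times> residue_box W b\<^sub>0 B.
      \<forall>p::nat. prime p \<longrightarrow> z < p \<longrightarrow> real p \<le> B / (64 * n * W) \<longrightarrow>
        \<not> (int p)\<^sup>2 dvd trinomial_disc n a b \<and> \<not> (int p)\<^sup>2 dvd trinomial_disc n (- a) b}"
    have cardG: "real (card G) \<ge> A * B / (32 * W\<^sup>2)"
      unfolding G_def
    proof (rule card_no_medium_square_factors_ge)
      show "\<not> int p dvd W" if "prime p" "p > z" for p
        using that WP by (simp add: z_def)
    qed (use n2 W AW AB in \<open>auto simp: z_def\<close>)
    have Gprop: "a > 0 \<and> (\<exists>s\<in>{1, -1}. (s * a, b) \<in> M_set n A B)" if "(a, b) \<in> G" for a b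
    proof -
      have ab: "A \<le> a" "a \<le> 2 * A" "B \<le> b" "b \<le> 2 * B" "[a = a\<^sub>0] (mod W)" "[b = b\<^sub>0] (mod W)"
        using that by (auto simp: G_def residue_box_def)
      have mid: "\<not> (int p)\<^sup>2 dvd trinomial_disc n (s * a) b"
        if "prime p" "z < p" "real p \<le> B / K" "s = 1 \<or> s = -1" for p s
        using \<open>(a, b) \<in> G\<close> that by (auto simp: G_def K_def)
      have pos: "a > 0" "b > 0" using ab A AB by auto
      have pb: "\<not> int p dvd b" if p: "prime p" "p \<le> z" "\<not> p dvd n" for p
      proof
        assume d: "int p dvd b"
        obtain \<beta> where \<beta>: "residue_primroot p \<beta>" "[b = int \<beta>] (mod int p)" using bP[OF ab(6) p] by blast
        then have "int p dvd int \<beta>" using d cong_dvd_iff by blast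
        then have "p dvd \<beta>" by simp
        have "Rings.coprime p \<beta>" using \<beta>(1) by (simp add: residue_primroot_def)
        then have "gcd p \<beta> = 1" by (rule coprime_imp_gcd_eq_1)
        moreover have "p dvd gcd p \<beta>" using \<open>p dvd \<beta>\<close> by (intro gcd_greatest) auto
        ultimately show False using p(1) by simp
      qed
      have small: "\<not> int p dvd trinomial_disc n (s * a) b" if "prime p" "p \<le> z" "s = 1 \<or> s = -1" for p s
        using that n2 a1[OF ab(5)] aP[OF ab(5)] pb by (intro trinomial_disc_not_dvd_small) auto
      have not_sq: "\<not> (int p)\<^sup>2 dvd trinomial_disc n (s * a) b"
        if "prime p" "real p \<le> B / K" "s = 1 \<or> s = -1" for p s
      proof (cases "p \<le> z")
        case True
        have "int p dvd (int p)\<^sup>2" by (simp add: power2_eq_square)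
        then show ?thesis using small[OF that(1) True that(3)] dvd_trans by blast
      next
        case False
        then show ?thesis using mid that by simp
      qed
      \<comment> \<open>The residue classes exclude a common prime p \<le> z. A larger one divides
        both a and b, so p \<le> 2 A \<le> B / K, while p^2 divides the discriminant, against
        \<open>not_sq\<close>.\<close>
      have cop: "Rings.coprime (int n * b) (int (n - 1) * a)"
      proof (rule ccontr)
        assume nc: "\<not> Rings.coprime (int n * b) (int (n - 1) * a)"
        define g where "g = gcd (int n * b) (int (n - 1) * a)"
        have "g \<noteq> 1"
        proof
          assume "g = 1"
          then have "Rings.coprime (int n * b) (int (n - 1) * a)"
            unfolding g_def by (rule gcd_eq_1_imp_coprime)
          then show False using nc by contradiction
        qed
        moreover have "int n * b \<noteq> 0" using n0 pos by simp
        then have "g > 0" unfolding g_def gcd_pos_int by (rule disjI1)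
        ultimately have "\<not> is_unit g" "g \<noteq> 0" by simp_all
        then obtain q :: int where "q dvd g" and q1: "prime q" using prime_divisor_exists by blast
        then have q: "prime q" "q dvd gcd (int n * b) (int (n - 1) * a)" by (simp_all only: g_def)
        define p where "p = nat q"
        have qp: "q = int p" using q(1) prime_gt_0_int[of q] by (simp add: p_def)
        have p: "prime p" using q(1) by (simp add: qp)
        have pi: "prime (int p)" using p by simp
        have d: "int p dvd int n * b" "int p dvd int (n - 1) * a" using q(2) unfolding qp by auto
        have dn: "p dvd n \<or> int p dvd b" "p dvd n - 1 \<or> int p dvd a"
          using d by (auto simp: prime_dvd_mult_iff[OF pi])
        have pa1: "\<not> int p dvd a" if "p dvd n"
        proof
          assume "int p dvd a"
          moreover have "[a = 1] (mod int p)" using a1[OF ab(5)] that by (auto intro: cong_dvd_modulus)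
          ultimately have "int p dvd 1" using cong_dvd_iff by blast
          then show False using pi by auto
        qed
        have pn1: "\<not> (p dvd n \<and> p dvd n - 1)"
        proof
          assume "p dvd n \<and> p dvd n - 1"
          then have "p dvd n - (n - 1)" using dvd_diff_nat by blast
          then show False using p n0 by simp
        qed
        have pn: "\<not> p dvd n" using dn(2) pa1 pn1 by blast
        then have db: "int p dvd b" using dn(1) by blast
        then have pz: "p > z" using pb[OF p] pn by (meson not_le)
        have "\<not> p dvd n - 1"
        proof
          assume "p dvd n - 1"
          then have "p \<le> n - 1" using n2 by (intro dvd_imp_le) auto
          moreover have "64 * n < p" using pz by (simp add: z_def)
          ultimately show False by linarith
        qed
        then have da: "int p dvd a" using dn(2) by blast
        then have "int p \<le> a" using pos by (intro zdvd_imp_le)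
        then have "real p \<le> B / K" using ab(2) AK by linarith
        moreover have "(int p)\<^sup>2 dvd trinomial_disc n (1 * a) b"
        proof -
          have "(int p)\<^sup>2 dvd (int p) ^ n" "(int p)\<^sup>2 dvd (int p) ^ (n - 1)"
            using n_ge by (auto intro: le_imp_power_dvd)
          moreover have "(int p) ^ n dvd a ^ n" "(int p) ^ (n - 1) dvd b ^ (n - 1)"
            using da db by (auto intro: dvd_power_same)
          ultimately have "(int p)\<^sup>2 dvd a ^ n" "(int p)\<^sup>2 dvd b ^ (n - 1)" by (auto intro: dvd_trans)
          then show ?thesis unfolding trinomial_disc_def by simp
        qed
        ultimately show False using not_sq[OF p, of 1] by blast
      qed
      have irr: "irreducible (map_poly rat_of_int (trinomial n (s * a) b))" if s: "s = 1 \<or> s = -1" for s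
      proof (rule irreducible_trinomial)
        show "s * a \<noteq> 0" using s pos by auto
        fix p assume p: "prime p" "p dvd n"
        obtain q where q: "q \<le> z\<^sub>1" "prime q" "\<not> q dvd n" "p ^ multiplicity p n dvd q - 1" using z1[OF p] by blast
        have qz: "q \<le> z" using q(1) by (simp add: z_def)
        show "\<exists>q \<beta>. prime q \<and> int q dvd s * a \<and>
          p ^ multiplicity p n dvd q - 1 \<and> residue_primroot q \<beta> \<and> [b = int \<beta>] (mod int q)"
          using bP[OF ab(6) q(2) qz q(3)] aP[OF ab(5) q(2) qz q(3)] q by (meson dvd_mult)
      qed (use n_odd n2 in auto)
      \<comment> \<open>If both signs failed, each discriminant would have a prime square factor
        with prime above B / K, which the abc bound forbids.\<close>
      have sf: "\<exists>s\<in>{1, -1}. squarefree (trinomial_disc n (s * a) b)"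
      proof (rule ccontr)
        assume neg: "\<not> (\<exists>s\<in>{1, -1}. squarefree (trinomial_disc n (s * a) b))"
        have ex: "\<exists>p. prime p \<and> B / K < real p \<and> (int p)\<^sup>2 dvd trinomial_disc n (s * a) b" if s: "s = 1 \<or> s = -1" for s
        proof -
          \<comment> \<open>The discriminant is odd, since 2 is among the small primes.\<close>
          have nz: "trinomial_disc n (s * a) b \<noteq> 0"
          proof
            assume "trinomial_disc n (s * a) b = 0"
            moreover have "(2::nat) \<le> z" using n2 by (simp add: z_def)
            ultimately show False using small[of 2 s] s two_is_prime_nat by simp
          qed
          have "\<not> squarefree (trinomial_disc n (s * a) b)" using neg s by auto
          then obtain q where q: "prime q" "q\<^sup>2 dvd trinomial_disc n (s * a) b"
            using squarefree_factorial_semiring[OF nz] by blast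
          have qp: "q = int (nat q)" using prime_gt_0_int[OF q(1)] by simp
          have "prime (nat q)" using q(1) by (metis qp prime_nat_int_transfer)
          moreover have "(int (nat q))\<^sup>2 dvd trinomial_disc n (s * a) b" using q(2) qp by simp
          ultimately show ?thesis using not_sq[OF _ _ s, of "nat q"] by (meson not_le)
        qed
        obtain p\<^sub>1 where p1: "prime p\<^sub>1" "B / K < real p\<^sub>1" "(int p\<^sub>1)\<^sup>2 dvd trinomial_disc n a b" using ex[of 1] by auto
        obtain p\<^sub>2 where p2: "prime p\<^sub>2" "B / K < real p\<^sub>2" "(int p\<^sub>2)\<^sup>2 dvd trinomial_disc n (-a) b" using ex[of "-1"] by auto
        have "real_of_int a \<le> 2 * real_of_int A" "real_of_int b \<le> 2 * real_of_int B" using ab by linarith+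
        moreover have "(1::real) \<le> A" "B\<^sub>1 \<le> B" using A AB AB1 by linarith+
        ultimately show False using B1[rule_format, of A B a b p\<^sub>1 p\<^sub>2] B pos cop p1 p2 by blast
      qed
      then obtain s where s: "s = 1 \<or> s = -1" "squarefree (trinomial_disc n (s * a) b)" by blast
      have "poly_disc (trinomial n (s * a) b) = trinomial_disc n (s * a) b"
        unfolding trinomial_disc_def using n2 n_mod s pos by (intro poly_disc_trinomial) auto
      then have "(s * a, b) \<in> M_set n A B"
        unfolding M_set_def using s irr[OF s(1)] ab pos by auto
      then show ?thesis using s(1) pos by blast
    qed
    \<comment> \<open>A good sign for each surviving pair. As a is positive, it is recovered from s
      a by the absolute value, so the resulting map from \<open>G\<close> is injective.\<close>
    define s where "s = (\<lambda>(a, b). SOME s::int. s \<in> {1, -1} \<and> (s * a, b) \<in> M_set n A B)"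
    have s: "s (a, b) \<in> {1, -1}" "(s (a, b) * a, b) \<in> M_set n A B" if "(a, b) \<in> G" for a b
    proof -
      have "\<exists>t. t \<in> {1, -1} \<and> (t * a, b) \<in> M_set n A B" using Gprop[OF that] by blast
      from someI_ex[OF this] show "s (a, b) \<in> {1, -1}" "(s (a, b) * a, b) \<in> M_set n A B"
        by (simp_all add: s_def)
    qed
    have "card G \<le> card (M_set n A B)"
    proof (rule card_inj_on_le)
      show "(\<lambda>(a, b). (s (a, b) * a, b)) ` G \<subseteq> M_set n A B" using s(2) by auto
      show "inj_on (\<lambda>(a, b). (s (a, b) * a, b)) G"
      proof (rule inj_onI)
        fix u v assume uv: "u \<in> G" "v \<in> G"
          and eq: "(\<lambda>(a, b). (s (a, b) * a, b)) u = (\<lambda>(a, b). (s (a, b) * a, b)) v"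
        obtain a b a' b' where e: "u = (a, b)" "v = (a', b')" by fastforce
        have g: "(a, b) \<in> G" "(a', b') \<in> G" using uv e by auto
        have abs: "\<bar>s (a, b) * a\<bar> = a" "\<bar>s (a', b') * a'\<bar> = a'"
          using s(1)[OF g(1)] s(1)[OF g(2)] Gprop[OF g(1)] Gprop[OF g(2)] by auto
        have eq': "s (a, b) * a = s (a', b') * a'" "b = b'" using eq unfolding e by auto
        have "a = a'" using abs unfolding eq'(1) by linarith
        then show "u = v" using eq'(2) unfolding e by simp
      qed
      show "finite (M_set n A B)"
        by (rule finite_subset[of _ "{-2 * A..2 * A} \<times> {-2 * B..2 * B}"]) (auto simp: M_set_def)
    qed
    then show ?thesis using cardG by (simp add: c_def)
  qed
  ultimately show ?thesis by blast
qed

end
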